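(* Let $W$ be a universal Coxeter group with Coxeter generators $S=\{s_1,s_2,\dots,s_{d+1}\}$, and for each integer $k\ge 0$ let $C_k$ be the word $s_1s_2\cdots s_k$, where subscripts are understood modulo $d+1$; words are identified with the elements of $W$ they represent. Then the Bruhat interval $[C_k,C_{d+k+1}]$ in $W$ is a dual stacked polytope of dimension $d$ with $d+k+1$ facets, meaning that the interval is isomorphic, as a poset, to the face lattice of such a polytope.
   Context: A Coxeter system $(W,S)$ is a group $W$ with generating set $S$ presented by the relations $(st)^{m(s,t)}=1$ for $s,t\in S$, where $m(s,s)=1$ and $2\le m(s,t)\le\infty$ for $s\ne t$ (with $m(s,t)=\infty$ meaning no relation). It is universal if $m(s,t)=\infty$ for all $s\ne t$. Subscripts modulo $d+1$ are taken in $\{1,\dots,d+1\}$; for example, if $d=2$ then $C_7=s_1s_2s_3s_1s_2s_3s_1$. $C_0$ is the empty word, representing the identity. A reduced word for $w\in W$ is a word in $S$ of minimal length representing $w$. Bruhat order on $W$: fixing a reduced word for $w$, $v\le w$ if and only if some subword of it is a reduced word for $v$. The interval $[u,w]$ is $\{v: u\le v\le w\}$ with the induced order. The face lattice of a convex polytope is the set of all its faces (including $\emptyset$ and the polytope itself) ordered by inclusion; a facet is a face of dimension one less than that of the polytope. For a polytope $P$ with a vertex $v$, choose a hyperplane $\{x: a\cdot x=b\}$ with $a\cdot v>b$ and $a\cdot v'<b$ for all other vertices $v'$ of $P$; the shaving of $P$ at $v$ is $P\cap\{x: a\cdot x\le b\}$ (unique up to combinatorial type). A polytope is dual stacked if it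 can be obtained from a simplex by a (possibly empty) series of vertex-shavings.
   Formalization: The formal theorem assumes d ≥ 2 or k = 0; the claim is false otherwise: for d = 1, k ≥ 1 the interval is a segment with 2 facets rather than k+2, and for d = 0, k ≥ 1 it is empty or a point, never having k+1 facets. *)

theory Defs
  imports
    "HOL-Analysis.Polytope"
    "HOL-Algebra.Generated_Groups"
    "HOL-Library.Extended_Nat"
    "HOL-Library.Sublist"
begin

section \<open>Group presentations and Coxeter systems\<close>

text \<open>A signed word stands for an element of the free group: \<open>(x, True)\<close> is the letter \<open>x\<close> and
  \<open>(x, False)\<close> is its formal inverse.\<close>

type_synonym 'a signed_word = "('a \<times> bool) list"

definition word_prod :: "('a, 'b) monoid_scheme \<Rightarrow> 'a list \<Rightarrow> 'a" where
  "word_prod G xs = foldr (\<lambda>x y. x \<otimes>\<^bsub>G\<^esub> y) xs \<one>\<^bsub>G\<^esub>"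

definition signed_word_prod :: "('a, 'b) monoid_scheme \<Rightarrow> 'a signed_word \<Rightarrow> 'a" where
  "signed_word_prod G w = word_prod G (map (\<lambda>(x, e). if e then x else inv\<^bsub>G\<^esub> x) w)"

text \<open>Two signed words over \<open>S\<close> are related iff they represent the same element of the abstract
  group \<open>\<langle>S | R\<rangle>\<close>, i.e.\ of the free group on \<open>S\<close> modulo the normal closure of the relators \<open>R\<close>.\<close>

inductive pres_equiv :: "'a set \<Rightarrow> 'a signed_word set \<Rightarrow> 'a signed_word \<Rightarrow> 'a signed_word \<Rightarrow> bool"
  for S :: "'a set" and R :: "'a signed_word set" where
  refl: "w \<in> lists (S \<times> UNIV) \<Longrightarrow> pres_equiv S R w w"
| sym: "pres_equiv S R v w \<Longrightarrow> pres_equiv S R w v"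
| trans: "pres_equiv S R u v \<Longrightarrow> pres_equiv S R v w \<Longrightarrow> pres_equiv S R u w"
| cancel: "u \<in> lists (S \<times> UNIV) \<Longrightarrow> v \<in> lists (S \<times> UNIV) \<Longrightarrow> x \<in> S \<Longrightarrow>
    pres_equiv S R (u @ [(x, e), (x, \<not> e)] @ v) (u @ v)"
| relator: "u \<in> lists (S \<times> UNIV) \<Longrightarrow> v \<in> lists (S \<times> UNIV) \<Longrightarrow> r \<in> R \<Longrightarrow>
    pres_equiv S R (u @ r @ v) (u @ v)"

definition presented_by :: "('a, 'b) monoid_scheme \<Rightarrow> 'a set \<Rightarrow> 'a signed_word set \<Rightarrow> bool" where
  "presented_by G S R \<longleftrightarrow>
     group G \<and> S \<subseteq> carrier G \<and> generate G S = carrier G \<and>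
     (\<forall>w \<in> lists (S \<times> UNIV). signed_word_prod G w = \<one>\<^bsub>G\<^esub> \<longleftrightarrow> pres_equiv S R w [])"

definition coxeter_matrix :: "'a set \<Rightarrow> ('a \<Rightarrow> 'a \<Rightarrow> enat) \<Rightarrow> bool" where
  "coxeter_matrix S m \<longleftrightarrow>
     (\<forall>s\<in>S. m s s = 1) \<and>
     (\<forall>s\<in>S. \<forall>t\<in>S. s \<noteq> t \<longrightarrow> 2 \<le> m s t) \<and>
     (\<forall>s\<in>S. \<forall>t\<in>S. m s t = m t s)"

definition coxeter_relators :: "'a set \<Rightarrow> ('a \<Rightarrow> 'a \<Rightarrow> enat) \<Rightarrow> 'a signed_word set" where
  "coxeter_relators S m =
     {concat (replicate n [(s, True), (t, True)]) |s t n. s \<in> S \<and> t \<in> S \<and> m s t = enat n}"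

definition coxeter_system :: "('a, 'b) monoid_scheme \<Rightarrow> 'a set \<Rightarrow> ('a \<Rightarrow> 'a \<Rightarrow> enat) \<Rightarrow> bool" where
  "coxeter_system W S m \<longleftrightarrow> coxeter_matrix S m \<and> presented_by W S (coxeter_relators S m)"

definition universal_coxeter_system ::
    "('a, 'b) monoid_scheme \<Rightarrow> 'a set \<Rightarrow> ('a \<Rightarrow> 'a \<Rightarrow> enat) \<Rightarrow> bool" where
  "universal_coxeter_system W S m \<longleftrightarrow>
     coxeter_system W S m \<and> (\<forall>s\<in>S. \<forall>t\<in>S. s \<noteq> t \<longrightarrow> m s t = \<infinity>)"

section \<open>Bruhat order\<close>

definition reduced_word :: "('a, 'b) monoid_scheme \<Rightarrow> 'a set \<Rightarrow> 'a list \<Rightarrow> 'a \<Rightarrow> bool" where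
  "reduced_word W S xs w \<longleftrightarrow>
     xs \<in> lists S \<and> word_prod W xs = w \<and>
     (\<forall>ys \<in> lists S. word_prod W ys = w \<longrightarrow> length xs \<le> length ys)"

text \<open>In a Coxeter group the choice of the reduced word \<open>ws\<close> for \<open>w\<close> does not matter; subwords
  need not be contiguous.\<close>

definition bruhat_le :: "('a, 'b) monoid_scheme \<Rightarrow> 'a set \<Rightarrow> 'a \<Rightarrow> 'a \<Rightarrow> bool" where
  "bruhat_le W S v w \<longleftrightarrow>
     (\<exists>ws vs. reduced_word W S ws w \<and> subseq vs ws \<and> reduced_word W S vs v)"

definition bruhat_interval :: "('a, 'b) monoid_scheme \<Rightarrow> 'a set \<Rightarrow> 'a \<Rightarrow> 'a \<Rightarrow> 'a set" where
  "bruhat_interval W S u w = {v \<in> carrier W. bruhat_le W S u v \<and> bruhat_le W S v w}"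

text \<open>The word \<open>s\<^sub>1 s\<^sub>2 \<dots> s\<^sub>k\<close> with subscripts reduced modulo \<open>n\<close> into \<open>{1..n}\<close>.\<close>

definition cyclic_word :: "nat \<Rightarrow> (nat \<Rightarrow> 'a) \<Rightarrow> nat \<Rightarrow> 'a list" where
  "cyclic_word n s k = map (\<lambda>i. s ((i - 1) mod n + 1)) [1..<k + 1]"

section \<open>Polytopes\<close>

text \<open>Unlike \<^const>\<open>facet_of\<close>, this makes the empty face (of dimension \<open>-1\<close>) a facet of a point.\<close>

definition facets :: "'a::euclidean_space set \<Rightarrow> 'a set set" where
  "facets P = {F. F face_of P \<and> aff_dim F = aff_dim P - 1}"

lemma facets_eq_facet_of:
  assumes "aff_dim P \<ge> 1"
  shows "facets P = {F. F facet_of P}"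
  using assms by (auto simp: facets_def facet_of_def)

definition face_lattice :: "'a::euclidean_space set \<Rightarrow> 'a set set" where
  "face_lattice P = {F. F face_of P}"

definition is_shaving :: "'a::euclidean_space set \<Rightarrow> 'a \<Rightarrow> 'a set \<Rightarrow> bool" where
  "is_shaving P v Q \<longleftrightarrow>
     v extreme_point_of P \<and>
     (\<exists>a b. a \<bullet> v > b \<and> (\<forall>v'. v' extreme_point_of P \<and> v' \<noteq> v \<longrightarrow> a \<bullet> v' < b) \<and>
            Q = P \<inter> {x. a \<bullet> x \<le> b})"

inductive dual_stacked :: "'a::euclidean_space set \<Rightarrow> bool" where
  simplex: "n simplex P \<Longrightarrow> dual_stacked P"
| shaving: "dual_stacked P \<Longrightarrow> is_shaving P v Q \<Longrightarrow> dual_stacked Q"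

definition poset_isomorphic ::
    "'a set \<Rightarrow> ('a \<Rightarrow> 'a \<Rightarrow> bool) \<Rightarrow> 'b set \<Rightarrow> ('b \<Rightarrow> 'b \<Rightarrow> bool) \<Rightarrow> bool" where
  "poset_isomorphic A leA B leB \<longleftrightarrow>
     (\<exists>f. bij_betw f A B \<and> (\<forall>x\<in>A. \<forall>y\<in>A. leA x y \<longleftrightarrow> leB (f x) (f y)))"

end

theory Submission
  imports Defs
begin

text \<open>
  In a universal Coxeter group an element has exactly one reduced word, and a word is reduced iff no
  two neighbouring letters agree. So Bruhat order is the subword order on such words
  (\<open>bruhat_le_iff_subseq\<close>), and the interval consists of the words between \<open>C\<^sub>k\<close> and
  \<open>C\<^sub>n\<^sub>+\<^sub>k\<close>, where \<open>n = d + 1\<close>.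

  Describe a word in the interval by the set of positions deleted from the top word. Equal letters
  sit at distance a multiple of \<open>n\<close>, so a set of fewer than \<open>n\<close> deleted positions is determined by
  the word, and for such sets the subword order is reverse inclusion (\<open>subseq_delete_positions_iff\<close>).
  Two conditions pick out the sets that occur. The word contains \<open>C\<^sub>k\<close> iff the set lies in a window
  \<open>{i..<i + n}\<close> with \<open>i \<le> k\<close>, and equal neighbours appear iff it is one of the intersections
  \<open>{i + 1..<i + n}\<close> of consecutive windows with \<open>i < k\<close>. For \<open>n \<ge> 2\<close> the sets with fewer than \<open>n\<close>
  elements that lie in a window and differ from all these intersections form the boundary complex
  of a stacked ball (\<open>stacked_complex\<close>): the windows are its simplices and the intersections of consecutive ones are its interior ridges.
  Together with the bottom element \<open>C\<^sub>k\<close>, for which a whole window is deleted, they give the interval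
  (\<open>word_interval_eq\<close>).

  On the geometric side, label every nonempty face of a polytope by the facets through it. Shaving a
  vertex with label \<open>D\<close> removes \<open>D\<close> and adds, with the number \<open>z\<close> of the new facet, the sets
  \<open>insert z D'\<close> for the proper subsets \<open>D'\<close> of \<open>D\<close> (\<open>face_labelling_shaved\<close>). This is exactly how
  the complex for \<open>k + 1\<close> arises from that for \<open>k\<close> (\<open>stacked_complex_Suc\<close>), and for \<open>k = 0\<close> the
  complex is that of a simplex. By induction some dual stacked polytope has the complex as its
  labels (\<open>ex_dual_stacked_polytope\<close>). Interval and face lattice are then both parametrised,
  reversing the order, by the labels and one further label for the bottom.
\<close>

section \<open>Reduced words in a universal Coxeter group\<close>

text \<open>Multiplying a word without equal neighbours by a letter on the left, again as a word without
  equal neighbours: the letter cancels against an equal first letter. On such words each letter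
  acts as an involution, so the universal Coxeter group acts on them; that action separates its
  elements.\<close>

fun push_letter :: "'a \<Rightarrow> 'a list \<Rightarrow> 'a list" where
  "push_letter x [] = [x]"
| "push_letter x (y # ys) = (if x = y then ys else x # y # ys)"

lemma distinct_adj_push_letter: "distinct_adj xs \<Longrightarrow> distinct_adj (push_letter x xs)"
  by (cases xs) (auto dest: distinct_adj_ConsD)

lemma push_letter_push_letter: "distinct_adj xs \<Longrightarrow> push_letter x (push_letter x xs) = xs"
  by (cases "(x, xs)" rule: push_letter.cases; cases "tl xs") auto

lemma distinct_adj_foldr_push_letter:
  "distinct_adj zs \<Longrightarrow> distinct_adj (foldr push_letter xs zs)"
  by (induction xs) (auto intro: distinct_adj_push_letter)

lemma foldr_push_letter_rev:
  "distinct_adj zs \<Longrightarrow> foldr push_letter (rev xs) (foldr push_letter xs zs) = zs"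
  by (induction xs) (auto simp: push_letter_push_letter distinct_adj_foldr_push_letter)

definition cancelled :: "'a list \<Rightarrow> 'a list" where
  "cancelled xs = foldr push_letter xs []"

lemma distinct_adj_cancelled: "distinct_adj (cancelled xs)"
  by (simp add: cancelled_def distinct_adj_foldr_push_letter)

lemma cancelled_id: "distinct_adj xs \<Longrightarrow> cancelled xs = xs"
proof (induction xs)
  case (Cons x xs)
  then show ?case by (cases xs) (auto simp: cancelled_def)
qed (simp add: cancelled_def)

lemma length_push_letter: "length (push_letter x xs) \<le> Suc (length xs)"
  by (cases xs) auto

lemma length_cancelled: "length (cancelled xs) \<le> length xs"
proof (induction xs)
  case (Cons x xs)
  then show ?case
    using length_push_letter[of x "cancelled xs"] by (simp add: cancelled_def)
qed (simp add: cancelled_def)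

lemma length_cancelled_less: "cancelled xs \<noteq> xs \<Longrightarrow> length (cancelled xs) < length xs"
proof (induction xs)
  case (Cons x xs)
  show ?case
  proof (cases "cancelled xs = xs")
    case True
    then show ?thesis using Cons.prems by (cases xs) (auto simp: cancelled_def split: if_splits)
  next
    case False
    then show ?thesis
      using Cons.IH length_push_letter[of x "cancelled xs"] by (simp add: cancelled_def)
  qed
qed (simp add: cancelled_def)

lemma set_push_letter: "set (push_letter x xs) \<subseteq> insert x (set xs)"
  by (cases xs) auto

lemma set_cancelled: "set (cancelled xs) \<subseteq> set xs"
proof (induction xs)
  case (Cons x xs)
  then show ?case
    using set_push_letter[of x "cancelled xs"] by (auto simp: cancelled_def)
qed (simp add: cancelled_def)

text \<open>The action respects every relation \<open>x x = 1\<close> and the cancellation of formal inverses, because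
  each letter acts as an involution. Hence it is constant on the elements of the presented group.\<close>

lemma pres_equiv_foldr_push_letter:
  assumes "pres_equiv S R u v" and "\<And>r. r \<in> R \<Longrightarrow> \<exists>x. map fst r = [x, x]"
    and "distinct_adj zs"
  shows "foldr push_letter (map fst u) zs = foldr push_letter (map fst v) zs"
  using assms
proof (induction arbitrary: zs rule: pres_equiv.induct)
  case (cancel u v x e)
  then show ?case by (simp add: push_letter_push_letter distinct_adj_foldr_push_letter)
next
  case (relator u v r)
  from relator.prems(1)[OF relator.hyps(3)] obtain x where "map fst r = [x, x]" ..
  then show ?case
    using relator.prems by (simp add: push_letter_push_letter distinct_adj_foldr_push_letter)
qed auto

lemma universal_coxeter_relators:
  assumes "universal_coxeter_system W S m"
  shows "coxeter_relators S m = (\<lambda>s. [(s, True), (s, True)]) ` S"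
proof -
  have "(s \<in> S \<and> t \<in> S \<and> m s t = enat n) \<longleftrightarrow> (s \<in> S \<and> t = s \<and> n = 1)" for s t n
    using assms
    unfolding universal_coxeter_system_def coxeter_system_def coxeter_matrix_def
    by (metis enat.distinct(1) enat.inject one_enat_def)
  then show ?thesis
    by (auto simp: coxeter_relators_def)
qed

context
  fixes W :: "('w, 'm) monoid_scheme" and S :: "'w set" and m :: "'w \<Rightarrow> 'w \<Rightarrow> enat"
  assumes universal: "universal_coxeter_system W S m"
begin

lemma presented_by_squares:
  "presented_by W S ((\<lambda>s. [(s, True), (s, True)]) ` S)"
  using universal universal_coxeter_relators[OF universal]
  by (simp add: universal_coxeter_system_def coxeter_system_def)

lemma group_W: "group W" and generators_subset: "S \<subseteq> carrier W"
  and generate_generators: "generate W S = carrier W"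
  using presented_by_squares by (auto simp: presented_by_def)

interpretation group W by (rule group_W)

lemma word_prod_closed: "xs \<in> lists S \<Longrightarrow> word_prod W xs \<in> carrier W"
  using generators_subset by (induction xs) (auto simp: word_prod_def)

lemma word_prod_Cons: "word_prod W (x # xs) = x \<otimes>\<^bsub>W\<^esub> word_prod W xs"
  by (simp add: word_prod_def)

lemma word_prod_append:
  "xs \<in> lists S \<Longrightarrow> ys \<in> lists S \<Longrightarrow>
    word_prod W (xs @ ys) = word_prod W xs \<otimes>\<^bsub>W\<^esub> word_prod W ys"
proof (induction xs)
  case Nil
  then show ?case using word_prod_closed[of ys] by (simp add: word_prod_def)
next
  case (Cons x xs)
  then have "x \<in> carrier W" "word_prod W xs \<in> carrier W" "word_prod W ys \<in> carrier W"
    using generators_subset word_prod_closed by auto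
  then show ?case using Cons by (simp add: word_prod_Cons m_assoc)
qed

lemma generator_square: "x \<in> S \<Longrightarrow> x \<otimes>\<^bsub>W\<^esub> x = \<one>\<^bsub>W\<^esub>"
proof -
  assume x: "x \<in> S"
  let ?R = "(\<lambda>s. [(s, True), (s, True)]) ` S"
  have "pres_equiv S ?R ([] @ [(x, True), (x, True)] @ []) ([] @ [])"
    using x by (intro pres_equiv.relator) auto
  moreover have "[(x, True), (x, True)] \<in> lists (S \<times> UNIV)"
    using x by auto
  ultimately have "signed_word_prod W [(x, True), (x, True)] = \<one>\<^bsub>W\<^esub>"
    using presented_by_squares unfolding presented_by_def by simp
  then show ?thesis
    using x generators_subset by (auto simp: signed_word_prod_def word_prod_def)
qed

lemma word_prod_push_letter:
  assumes "x \<in> S" "xs \<in> lists S"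
  shows "word_prod W (push_letter x xs) = x \<otimes>\<^bsub>W\<^esub> word_prod W xs"
proof (cases xs)
  case (Cons y ys)
  then have ys: "word_prod W ys \<in> carrier W" "x \<in> carrier W"
    using assms generators_subset word_prod_closed by auto
  then have "x \<otimes>\<^bsub>W\<^esub> (x \<otimes>\<^bsub>W\<^esub> word_prod W ys) = word_prod W ys"
    using generator_square[OF assms(1)] by (simp flip: m_assoc)
  then show ?thesis using Cons by (auto simp: word_prod_Cons)
qed (simp add: word_prod_def)

lemma cancelled_in_lists: "xs \<in> lists S \<Longrightarrow> cancelled xs \<in> lists S"
  using set_cancelled[of xs] by auto

lemma word_prod_cancelled: "xs \<in> lists S \<Longrightarrow> word_prod W (cancelled xs) = word_prod W xs"
proof (induction xs)
  case (Cons x xs)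
  have "cancelled (x # xs) = push_letter x (cancelled xs)"
    by (simp add: cancelled_def)
  then show ?case
    using Cons cancelled_in_lists[of xs] word_prod_push_letter[of x "cancelled xs"]
    by (auto simp: word_prod_Cons)
qed (simp add: cancelled_def)

lemma word_prod_append_rev: "xs \<in> lists S \<Longrightarrow> word_prod W (xs @ rev xs) = \<one>\<^bsub>W\<^esub>"
proof (induction xs)
  case (Cons x xs)
  have "x \<in> carrier W" "x \<in> S" "xs \<in> lists S" "rev xs \<in> lists S"
    using Cons generators_subset by auto
  moreover have "word_prod W ((xs @ rev xs) @ [x]) = word_prod W (xs @ rev xs) \<otimes>\<^bsub>W\<^esub> word_prod W [x]"
    using calculation by (intro word_prod_append) auto
  ultimately show ?case
    using Cons generator_square by (simp add: word_prod_def)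
qed (simp add: word_prod_def)

text \<open>Acting with \<open>xs @ rev ys\<close>, which represents the identity, fixes the normal form of \<open>ys\<close>;
  but \<open>rev ys\<close> sends it to the empty word, and \<open>xs\<close> sends the empty word to the normal form of
  \<open>xs\<close>.\<close>

lemma cancelled_eqI:
  assumes xs: "xs \<in> lists S" and ys: "ys \<in> lists S" and eq: "word_prod W xs = word_prod W ys"
  shows "cancelled xs = cancelled ys"
proof -
  let ?R = "(\<lambda>s. [(s, True), (s, True)]) ` S"
  let ?w = "map (\<lambda>x. (x, True)) (xs @ rev ys)"
  have rev: "rev ys \<in> lists S" using ys by auto
  have "word_prod W (xs @ rev ys) = word_prod W (ys @ rev ys)"
    using xs ys rev eq by (simp add: word_prod_append)
  then have "word_prod W (xs @ rev ys) = \<one>\<^bsub>W\<^esub>"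
    using ys word_prod_append_rev by simp
  moreover have "signed_word_prod W ?w = word_prod W (xs @ rev ys)"
    by (simp add: signed_word_prod_def comp_def)
  moreover have "?w \<in> lists (S \<times> UNIV)"
    using xs ys by auto
  moreover have "\<forall>w \<in> lists (S \<times> UNIV). signed_word_prod W w = \<one>\<^bsub>W\<^esub> \<longleftrightarrow> pres_equiv S ?R w []"
    using presented_by_squares unfolding presented_by_def by (elim conjE)
  ultimately have "pres_equiv S ?R ?w []" by auto
  then have "foldr push_letter (map fst ?w) (cancelled ys) = foldr push_letter (map fst ([] :: 'w signed_word)) (cancelled ys)"
    by (rule pres_equiv_foldr_push_letter) (auto intro: distinct_adj_cancelled)
  then have "foldr push_letter xs (foldr push_letter (rev ys) (foldr push_letter ys [])) = cancelled ys"
    by (simp add: comp_def cancelled_def)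
  then show ?thesis
    by (simp add: foldr_push_letter_rev cancelled_def)
qed

lemma reduced_word_iff:
  "reduced_word W S xs w \<longleftrightarrow> xs \<in> lists S \<and> distinct_adj xs \<and> word_prod W xs = w"
proof
  assume *: "reduced_word W S xs w"
  then have xs: "xs \<in> lists S" "word_prod W xs = w"
    by (auto simp: reduced_word_def)
  have "length xs \<le> length (cancelled xs)"
    using * xs cancelled_in_lists word_prod_cancelled unfolding reduced_word_def by metis
  then have "cancelled xs = xs" using length_cancelled_less[of xs] by fastforce
  then have "distinct_adj xs" using distinct_adj_cancelled by metis
  then show "xs \<in> lists S \<and> distinct_adj xs \<and> word_prod W xs = w" using xs by simp
next
  assume *: "xs \<in> lists S \<and> distinct_adj xs \<and> word_prod W xs = w"
  have "length xs \<le> length ys" if "ys \<in> lists S" "word_prod W ys = w" for ys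
    using * that cancelled_eqI[of xs ys] cancelled_id[of xs] length_cancelled[of ys] by simp
  then show "reduced_word W S xs w" using * by (simp add: reduced_word_def)
qed

lemma word_prod_inject:
  assumes "xs \<in> lists S" "distinct_adj xs" "ys \<in> lists S" "distinct_adj ys"
    and "word_prod W xs = word_prod W ys"
  shows "xs = ys"
  using assms cancelled_eqI[of xs ys] by (simp add: cancelled_id)

text \<open>Every element has just one reduced word, so there is no choice left in the definition of the
  Bruhat order.\<close>

lemma bruhat_le_iff_subseq:
  assumes "xs \<in> lists S" "distinct_adj xs" "ys \<in> lists S" "distinct_adj ys"
  shows "bruhat_le W S (word_prod W xs) (word_prod W ys) \<longleftrightarrow> subseq xs ys"
proof
  assume "bruhat_le W S (word_prod W xs) (word_prod W ys)"
  then obtain ws vs where ws: "ws \<in> lists S" "distinct_adj ws" "word_prod W ws = word_prod W ys"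
    and vs: "vs \<in> lists S" "distinct_adj vs" "word_prod W vs = word_prod W xs" and "subseq vs ws"
    unfolding bruhat_le_def reduced_word_iff by (elim exE conjE) (rule that)
  moreover have "ws = ys" using word_prod_inject ws assms by metis
  moreover have "vs = xs" using word_prod_inject vs assms by metis
  ultimately show "subseq xs ys" by simp
next
  assume "subseq xs ys"
  then show "bruhat_le W S (word_prod W xs) (word_prod W ys)"
    unfolding bruhat_le_def reduced_word_iff using assms by (intro exI[of _ xs] exI[of _ ys]) simp
qed

lemma ex_distinct_adj_word:
  assumes "w \<in> carrier W"
  obtains xs where "xs \<in> lists S" "distinct_adj xs" "word_prod W xs = w"
proof -
  have "w \<in> generate W S" using assms generate_generators by simp
  then have "\<exists>ys \<in> lists S. word_prod W ys = w"
  proof (induction rule: generate.induct)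
    case one
    then show ?case by (intro bexI[of _ "[]"]) (auto simp: word_prod_def)
  next
    case (incl h)
    then show ?case
      using generators_subset by (intro bexI[of _ "[h]"]) (auto simp: word_prod_def)
  next
    case (inv h)
    then have "inv\<^bsub>W\<^esub> h = h"
      using generators_subset generator_square by (auto intro!: inv_equality)
    then show ?case
      using inv generators_subset by (intro bexI[of _ "[h]"]) (auto simp: word_prod_def)
  next
    case (eng h1 h2)
    then obtain xs ys where "xs \<in> lists S" "word_prod W xs = h1" "ys \<in> lists S" "word_prod W ys = h2"
      by blast
    then show ?case using word_prod_append by (intro bexI[of _ "xs @ ys"]) auto
  qed
  then obtain ys where "ys \<in> lists S" "word_prod W ys = w" by blast
  then show thesis
    by (intro that[of "cancelled ys"])
      (simp_all add: distinct_adj_cancelled cancelled_in_lists word_prod_cancelled)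
qed

lemma bruhat_interval_eq:
  assumes "us \<in> lists S" "distinct_adj us" "ws \<in> lists S" "distinct_adj ws"
  shows "bruhat_interval W S (word_prod W us) (word_prod W ws) =
    word_prod W ` {xs. distinct_adj xs \<and> subseq us xs \<and> subseq xs ws}"
proof -
  have sub: "xs \<in> lists S" if "subseq xs ws" for xs
    using that assms(3) set_nths_subset unfolding subseq_conv_nths by fastforce
  show ?thesis
  proof (intro equalityI subsetI)
    fix w assume w: "w \<in> bruhat_interval W S (word_prod W us) (word_prod W ws)"
    then obtain xs where "xs \<in> lists S" "distinct_adj xs" "word_prod W xs = w"
      using ex_distinct_adj_word by (auto simp: bruhat_interval_def)
    then show "w \<in> word_prod W ` {xs. distinct_adj xs \<and> subseq us xs \<and> subseq xs ws}"
      using w assms bruhat_le_iff_subseq by (auto simp: bruhat_interval_def)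
  next
    fix w assume "w \<in> word_prod W ` {xs. distinct_adj xs \<and> subseq us xs \<and> subseq xs ws}"
    then show "w \<in> bruhat_interval W S (word_prod W us) (word_prod W ws)"
      using assms sub bruhat_le_iff_subseq word_prod_closed
      by (auto simp: bruhat_interval_def)
  qed
qed

end

section \<open>Deleting positions from a cyclic word\<close>

text \<open>Positions are counted from \<open>0\<close>: the letter at position \<open>j\<close> has subscript \<open>j mod n + 1\<close>.\<close>

definition remaining :: "nat \<Rightarrow> nat set \<Rightarrow> nat list" where
  "remaining N D = filter (\<lambda>j. j \<notin> D) [0..<N]"

lemma sorted_remaining: "sorted_wrt (<) (remaining N D)"
  by (simp add: remaining_def sorted_wrt_filter)

lemma set_remaining: "set (remaining N D) = {..<N} - D"
  by (auto simp: remaining_def)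

lemma length_remaining: "D \<subseteq> {..<N} \<Longrightarrow> length (remaining N D) = N - card D"
  using distinct_card[of "remaining N D"] 
  by (simp add: set_remaining card_Diff_subset finite_subset) (simp add: remaining_def)

text \<open>At most \<open>card D\<close> positions are skipped before any remaining one. This confines the position of
  the \<open>a\<close>-th remaining letter to a range of \<open>card D + 1\<close> values, so that its residue modulo \<open>n\<close>
  determines it as soon as \<open>card D < n\<close>.\<close>

lemma remaining_nth_bounds:
  assumes "a < length (remaining N D)"
  shows "a \<le> remaining N D ! a" "remaining N D ! a \<le> a + card (D \<inter> {..<N})"
proof -
  show "a \<le> remaining N D ! a"
    using sorted_wrt_less_idx[OF sorted_remaining assms] .
  show "remaining N D ! a \<le> a + card (D \<inter> {..<N})"
    using assms
  proof (induction N)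
    case (Suc N)
    have step: "remaining (Suc N) D = remaining N D @ (if N \<in> D then [] else [N])"
      by (simp add: remaining_def)
    have mono: "card (D \<inter> {..<N}) \<le> card (D \<inter> {..<Suc N})"
      by (intro card_mono) auto
    show ?case
    proof (cases "a < length (remaining N D)")
      case True
      then have "remaining N D ! a \<le> a + card (D \<inter> {..<N})" by (rule Suc.IH)
      then show ?thesis using True mono by (simp add: step nth_append)
    next
      case False
      then have a: "a = length (remaining N D)" "N \<notin> D"
        using Suc.prems by (auto simp: step split: if_splits)
      have "a = card ({..<N} - D)"
        using a distinct_card[of "remaining N D"] by (simp add: set_remaining) (simp add: remaining_def)
      moreover have "card ({..<N} - D) + card (D \<inter> {..<N}) = card (({..<N} - D) \<union> (D \<inter> {..<N}))"
        by (intro card_Un_disjoint[symmetric]) auto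
      moreover have "({..<N} - D) \<union> (D \<inter> {..<N}) = {..<N}" by auto
      ultimately have "N = a + card (D \<inter> {..<N})" by simp
      then show ?thesis using a mono by (simp add: step nth_append)
    qed
  qed (simp add: remaining_def)
qed

definition cyclic_letter :: "nat \<Rightarrow> (nat \<Rightarrow> 'a) \<Rightarrow> nat \<Rightarrow> 'a" where
  "cyclic_letter n s j = s (j mod n + 1)"

definition delete_positions :: "nat \<Rightarrow> (nat \<Rightarrow> 'a) \<Rightarrow> nat \<Rightarrow> nat set \<Rightarrow> 'a list" where
  "delete_positions n s N D = map (cyclic_letter n s) (remaining N D)"

lemma cyclic_word_conv_map: "cyclic_word n s N = map (cyclic_letter n s) [0..<N]"
proof -
  have "[1..<N + 1] = map Suc [0..<N]" by (simp add: map_Suc_upt)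
  then show ?thesis unfolding cyclic_word_def cyclic_letter_def by (simp add: comp_def)
qed

lemma delete_positions_empty: "delete_positions n s N {} = cyclic_word n s N"
  by (simp add: delete_positions_def remaining_def cyclic_word_conv_map)

lemma length_delete_positions:
  "D \<subseteq> {..<N} \<Longrightarrow> length (delete_positions n s N D) = N - card D"
  by (simp add: delete_positions_def length_remaining)

lemma subseq_delete_positions_mono:
  assumes "D \<subseteq> E"
  shows "subseq (delete_positions n s N E) (delete_positions n s N D)"
proof -
  have "remaining N E = filter (\<lambda>j. j \<notin> E) (remaining N D)"
    using assms unfolding remaining_def filter_filter by (intro filter_cong) auto
  then show ?thesis unfolding delete_positions_def by (metis subseq_filter_left subseq_map)
qed

lemma subseq_delete_positionsE:
  assumes "subseq xs (delete_positions n s N D)"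
  obtains E where "D \<inter> {..<N} \<subseteq> E" "E \<subseteq> {..<N}" "xs = delete_positions n s N E"
proof -
  obtain A where A: "xs = nths (delete_positions n s N D) A"
    using assms subseq_conv_nths by blast
  define h where "h = nths (remaining N D) A"
  have seth: "set h \<subseteq> {..<N} - D"
    using set_nths_subset unfolding h_def set_remaining[symmetric] .
  have "distinct (remaining N D)" by (simp add: remaining_def)
  then have "h = filter (\<lambda>j. j \<in> set h) (remaining N D)"
    unfolding h_def by (rule filter_in_nths[symmetric])
  also have "\<dots> = remaining N ({..<N} - set h)"
    unfolding remaining_def filter_filter using seth by (intro filter_cong) auto
  finally have "h = remaining N ({..<N} - set h)" .
  then have "xs = delete_positions n s N ({..<N} - set h)"
    unfolding delete_positions_def A h_def nths_map by simp
  then show thesis using seth by (intro that[of "{..<N} - set h"]) auto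
qed

lemma mod_eq_imp_eq_in_window:
  fixes x y a n :: nat
  assumes "x mod n = y mod n" "a \<le> x" "x < a + n" "a \<le> y" "y < a + n"
  shows "x = y"
proof -
  have "x = y" if "x mod n = y mod n" "a \<le> x" "x \<le> y" "y < a + n" for x y :: nat
  proof -
    have "n dvd y - x" using that mod_eq_dvd_iff_nat[of x y n] by simp
    moreover have "y - x < n" using that by linarith
    ultimately have "y - x = 0" using dvd_imp_le[of n "y - x"] by (cases "y - x = 0") auto
    then show ?thesis using that by simp
  qed
  then show ?thesis using assms by (metis linear)
qed

context
  fixes n :: nat and s :: "nat \<Rightarrow> 'a"
  assumes n: "n \<ge> 1" and inj: "inj_on s {1..n}"
begin

lemma cyclic_letter_eq_iff: "cyclic_letter n s i = cyclic_letter n s j \<longleftrightarrow> i mod n = j mod n"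
proof -
  have "i mod n + 1 \<in> {1..n}" "j mod n + 1 \<in> {1..n}"
    using n by (simp_all add: Suc_leI)
  then show ?thesis using inj_on_eq_iff[OF inj] by (simp add: cyclic_letter_def)
qed

text \<open>The letter in place \<open>a\<close> of the common word fixes a residue modulo \<open>n\<close>, and both positions it
  can come from lie in the window \<open>{a..<a + n}\<close>, so they agree.\<close>

lemma delete_positions_inject:
  assumes D: "D \<subseteq> {..<N}" "card D < n" and E: "E \<subseteq> {..<N}"
    and eq: "delete_positions n s N D = delete_positions n s N E"
  shows "D = E"
proof -
  have cards: "card D \<le> N" "card E \<le> N"
    using D(1) E card_mono[of "{..<N}"] by simp_all
  have len: "length (remaining N D) = length (remaining N E)"
    using eq unfolding delete_positions_def by (rule map_eq_imp_length_eq)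
  then have card: "card E = card D"
    using cards length_remaining[OF D(1)] length_remaining[OF E] by linarith
  have "remaining N D = remaining N E"
  proof (rule nth_equalityI[OF len])
    fix a assume a: "a < length (remaining N D)"
    have "delete_positions n s N D ! a = delete_positions n s N E ! a" using eq by simp
    then have "cyclic_letter n s (remaining N D ! a) = cyclic_letter n s (remaining N E ! a)"
      using a len by (simp add: delete_positions_def)
    then have "remaining N D ! a mod n = remaining N E ! a mod n"
      by (simp only: cyclic_letter_eq_iff)
    moreover have "D \<inter> {..<N} = D" "E \<inter> {..<N} = E" using D E by auto
    then have "a \<le> remaining N D ! a" "remaining N D ! a < a + n"
      "a \<le> remaining N E ! a" "remaining N E ! a < a + n"
      using remaining_nth_bounds[OF a] remaining_nth_bounds[of a N E] a len card D(2) by simp_all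
    ultimately show "remaining N D ! a = remaining N E ! a"
      by (rule mod_eq_imp_eq_in_window)
  qed
  then have "{..<N} - D = {..<N} - E" by (metis set_remaining)
  then show ?thesis using D(1) E by blast
qed

text \<open>A subword of the word with \<open>D\<close> deleted arises by deleting some larger set, and a deleted set of
  fewer than \<open>n\<close> positions can be read off from the word.\<close>

lemma subseq_delete_positions_iff:
  assumes D: "D \<subseteq> {..<N}" and E: "E \<subseteq> {..<N}" "card E < n"
  shows "subseq (delete_positions n s N E) (delete_positions n s N D) \<longleftrightarrow> D \<subseteq> E"
proof
  assume "subseq (delete_positions n s N E) (delete_positions n s N D)"
  then obtain E' where E': "D \<inter> {..<N} \<subseteq> E'" "E' \<subseteq> {..<N}"
    "delete_positions n s N E = delete_positions n s N E'"
    by (rule subseq_delete_positionsE)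
  then have "E = E'" using delete_positions_inject E by blast
  then show "D \<subseteq> E" using E' D by blast
qed (rule subseq_delete_positions_mono)

text \<open>Neighbours become equal only if the deleted positions between them fill a gap whose length is
  \<open>n - 1\<close> modulo \<open>n\<close>. Fewer than \<open>n\<close> deletions can only fill a gap of
  length \<open>n - 1\<close>, and this uses up all of them.\<close>

lemma distinct_adj_delete_positions_iff:
  assumes D: "D \<subseteq> {..<N}" "card D < n"
  shows "distinct_adj (delete_positions n s N D) \<longleftrightarrow> (\<forall>p. p + n < N \<longrightarrow> D \<noteq> {p + 1..<p + n})"
proof
  assume distinct: "distinct_adj (delete_positions n s N D)"
  show "\<forall>p. p + n < N \<longrightarrow> D \<noteq> {p + 1..<p + n}"
  proof (intro allI impI notI)
    fix p assume p: "p + n < N" and Deq: "D = {p + 1..<p + n}"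
    have "remaining N D = [0..<p] @ [p, p + n] @ [p + n + 1..<N]"
    proof (rule strict_sorted_equal[OF _ sorted_remaining])
      show "sorted_wrt (<) ([0..<p] @ [p, p + n] @ [p + n + 1..<N])"
        using n by (auto simp: sorted_wrt_append)
      show "set (remaining N D) = set ([0..<p] @ [p, p + n] @ [p + n + 1..<N])"
        using p n by (auto simp: set_remaining Deq)
    qed
    then have "distinct_adj (map (cyclic_letter n s) [p, p + n])"
      using distinct unfolding delete_positions_def map_append
      by (auto dest: distinct_adj_appendD1 distinct_adj_appendD2)
    then show False by (simp add: cyclic_letter_eq_iff)
  qed
next
  assume gapless: "\<forall>p. p + n < N \<longrightarrow> D \<noteq> {p + 1..<p + n}"
  let ?g = "remaining N D"
  show "distinct_adj (delete_positions n s N D)"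
    unfolding distinct_adj_conv_nth
  proof (intro allI impI notI)
    fix a assume "Suc a < length (delete_positions n s N D)"
      and eq: "delete_positions n s N D ! a = delete_positions n s N D ! Suc a"
    then have a: "Suc a < length ?g" by (simp add: delete_positions_def)
    define p q where "p = ?g ! a" and "q = ?g ! Suc a"
    have mod: "p mod n = q mod n"
      using eq a by (simp add: delete_positions_def cyclic_letter_eq_iff p_def q_def)
    have "D \<inter> {..<N} = D" using D by auto
    then have bounds: "a \<le> p" "q \<le> Suc a + card D"
      using remaining_nth_bounds[of a N D] remaining_nth_bounds[of "Suc a" N D] a
      by (auto simp: p_def q_def)
    have "p < q" using sorted_wrt_nth_less[OF sorted_remaining _ a, of a] by (simp add: p_def q_def)
    have "q \<in> set ?g" using a by (simp add: q_def)
    then have "q < N" by (simp add: set_remaining)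
    have "n dvd q - p" using mod \<open>p < q\<close> mod_eq_dvd_iff_nat[of p q n] by simp
    then have "n \<le> q - p" using \<open>p < q\<close> by (simp add: dvd_imp_le)
    then have q: "q = p + n" using bounds D(2) by simp
    have "{p + 1..<p + n} \<subseteq> D"
    proof
      fix j assume j: "j \<in> {p + 1..<p + n}"
      show "j \<in> D"
      proof (rule ccontr)
        assume "j \<notin> D"
        then have "j \<in> set ?g" using j q \<open>q < N\<close> by (simp add: set_remaining)
        then obtain b where b: "b < length ?g" "j = ?g ! b" by (auto simp: in_set_conv_nth)
        have "\<not> b \<le> a"
          using sorted_wrt_nth_less[OF sorted_remaining, of b a N D] b a j
          by (cases "b = a") (auto simp: p_def)
        moreover have "\<not> Suc a \<le> b"
          using sorted_wrt_nth_less[OF sorted_remaining, of "Suc a" b N D] b j q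
          by (cases "b = Suc a") (auto simp: q_def)
        ultimately show False by simp
      qed
    qed
    moreover have "finite D" using D finite_subset by blast
    ultimately have "D = {p + 1..<p + n}" using D(2) by (intro card_seteq[symmetric]) auto
    then show False using gapless q \<open>q < N\<close> by blast
  qed
qed

lemma delete_window:
  assumes "i \<le> k"
  shows "delete_positions n s (n + k) {i..<i + n} = cyclic_word n s k"
proof -
  have "remaining (n + k) {i..<i + n} = [0..<i] @ map (\<lambda>j. j + n) [i..<k]"
  proof (rule strict_sorted_equal[OF _ sorted_remaining])
    show "sorted_wrt (<) ([0..<i] @ map (\<lambda>j. j + n) [i..<k])"
      by (auto simp: sorted_wrt_append sorted_wrt_map)
    have "set (map (\<lambda>j. j + n) [i..<k]) = {i + n..<k + n}"
      by (simp add: image_add_atLeastLessThan')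
    then show "set (remaining (n + k) {i..<i + n}) = set ([0..<i] @ map (\<lambda>j. j + n) [i..<k])"
      using assms by (auto simp: set_remaining)
  qed
  then have "delete_positions n s (n + k) {i..<i + n} = map (cyclic_letter n s) ([0..<i] @ [i..<k])"
    by (simp add: delete_positions_def cyclic_letter_def)
  also have "[0..<i] @ [i..<k] = [0..<k]"
    using assms upt_add_eq_append[of 0 i "k - i"] by simp
  finally show ?thesis by (simp add: cyclic_word_conv_map)
qed

text \<open>A remaining letter in place \<open>j\<close> keeps its residue, so it sits at position \<open>j\<close> or \<open>j + n\<close>.
  As positions increase, the shift by \<open>n\<close> persists once it occurs; the deleted positions are
  those jumped over at that point.\<close>

lemma cyclic_word_deletion_is_window:
  assumes E: "E \<subseteq> {..<n + k}" and eq: "cyclic_word n s k = delete_positions n s (n + k) E"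
  shows "\<exists>i\<le>k. E = {i..<i + n}"
proof -
  let ?g = "remaining (n + k) E"
  have len: "length ?g = k"
    using arg_cong[OF eq, of length] by (simp add: delete_positions_def cyclic_word_conv_map)
  have "card E \<le> n + k" using card_mono[OF _ E] by simp
  then have card: "card E = n" using len length_remaining[OF E] by simp
  have "E \<inter> {..<n + k} = E" using E by auto
  then have g: "?g ! j = j \<or> ?g ! j = j + n" if j: "j < k" for j
  proof -
    have bounds: "j \<le> ?g ! j" "?g ! j \<le> j + n"
      using remaining_nth_bounds[of j "n + k" E] j len card \<open>E \<inter> {..<n + k} = E\<close> by auto
    have "map (cyclic_letter n s) [0..<k] ! j = map (cyclic_letter n s) ?g ! j"
      using eq by (simp add: delete_positions_def cyclic_word_conv_map)
    then have "j mod n = ?g ! j mod n" using j len by (simp add: cyclic_letter_eq_iff)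
    then show ?thesis
      using bounds mod_eq_imp_eq_in_window[of j n "?g ! j" j] n by force
  qed
  \<comment> \<open>the place where the jump occurs, or \<open>k\<close> if the deleted positions are the last \<open>n\<close>\<close>
  define i where "i = (LEAST i. i = k \<or> ?g ! i = i + n)"
  have i: "i = k \<or> ?g ! i = i + n" and "i \<le> k"
    unfolding i_def by (rule LeastI[of _ k], simp) (rule Least_le, simp)
  have low: "?g ! j = j" if "j < i" for j
    using that g[of j] not_less_Least[of j "\<lambda>i. i = k \<or> ?g ! i = i + n"] \<open>i \<le> k\<close>
    unfolding i_def[symmetric] by auto
  have high: "?g ! j = j + n" if "i \<le> j" "j < k" for j
    using that
  proof (induction j rule: dec_induct)
    case (step j)
    then have "?g ! j < ?g ! Suc j"
      using sorted_wrt_nth_less[OF sorted_remaining, of j "Suc j" "n + k" E] len by simp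
    then show ?case using step g[of "Suc j"] n by auto
  qed (use i in auto)
  have "{..<i} \<subseteq> set ?g"
    using low len \<open>i \<le> k\<close> nth_mem[of _ ?g] by (metis lessThan_iff less_le_trans subsetI)
  moreover have "{i + n..<k + n} \<subseteq> set ?g"
  proof
    fix x assume x: "x \<in> {i + n..<k + n}"
    then have "?g ! (x - n) = x" "x - n < length ?g" using high[of "x - n"] len by auto
    then show "x \<in> set ?g" using nth_mem by metis
  qed
  ultimately have "E \<subseteq> {i..<i + n}" using E unfolding set_remaining
    by (fastforce simp: subset_iff not_less)
  then have "E = {i..<i + n}" using card by (intro card_seteq) auto
  then show ?thesis using \<open>i \<le> k\<close> by blast
qed

lemma cyclic_word_subseq_iff:
  assumes "D \<subseteq> {..<n + k}"
  shows "subseq (cyclic_word n s k) (delete_positions n s (n + k) D) \<longleftrightarrow> (\<exists>i\<le>k. D \<subseteq> {i..<i + n})"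
proof
  assume "subseq (cyclic_word n s k) (delete_positions n s (n + k) D)"
  then obtain E where E: "D \<inter> {..<n + k} \<subseteq> E" "E \<subseteq> {..<n + k}"
      "cyclic_word n s k = delete_positions n s (n + k) E"
    by (rule subseq_delete_positionsE)
  then obtain i where "i \<le> k" "E = {i..<i + n}"
    using cyclic_word_deletion_is_window[OF E(2,3)] by blast
  then show "\<exists>i\<le>k. D \<subseteq> {i..<i + n}" using E(1) assms by blast
next
  assume "\<exists>i\<le>k. D \<subseteq> {i..<i + n}"
  then obtain i where "i \<le> k" "D \<subseteq> {i..<i + n}" by blast
  then show "subseq (cyclic_word n s k) (delete_positions n s (n + k) D)"
    using subseq_delete_positions_mono[of D "{i..<i + n}" n s "n + k"] by (simp add: delete_window)
qed

end

section \<open>The boundary complex of a stacked ball\<close>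

text \<open>For \<open>n \<ge> 2\<close> this is the boundary complex of the ball made of the simplices \<open>{i..<i + n}\<close> for
  \<open>i \<le> k\<close>, where consecutive ones are glued along their common ridge \<open>{i + 1..<i + n}\<close>. The
  ridges that have been glued are interior, and a set with fewer than \<open>n\<close> elements contains such a
  ridge only by being equal to it.\<close>

definition stacked_complex :: "nat \<Rightarrow> nat \<Rightarrow> nat set set" where
  "stacked_complex n k =
     {D. card D < n \<and> (\<exists>i\<le>k. D \<subseteq> {i..<i + n}) \<and> (\<forall>i<k. D \<noteq> {i + 1..<i + n})}"

lemma stacked_complex_bounded: "D \<in> stacked_complex n k \<Longrightarrow> D \<subseteq> {..<n + k}"
  by (fastforce simp: stacked_complex_def)

lemma stacked_complex_0: "stacked_complex n 0 = {D. D \<subset> {..<n}}"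
proof -
  have "card D < n \<longleftrightarrow> D \<noteq> {..<n}" if "D \<subseteq> {..<n}" for D
    using that psubset_card_mono[of "{..<n}" D] by auto
  then show ?thesis by (auto simp: stacked_complex_def lessThan_atLeast0)
qed

text \<open>Gluing one more simplex with the new vertex \<open>n + k\<close> onto the ridge \<open>{k + 1..<k + n}\<close> buries
  that ridge and adds the cone over its boundary.\<close>

lemma stacked_complex_Suc:
  assumes n: "n \<ge> 2"
  shows "stacked_complex n (Suc k) =
    stacked_complex n k - {{k + 1..<k + n}} \<union> insert (n + k) ` {D. D \<subset> {k + 1..<k + n}}"
    (is "_ = ?R")
proof (intro equalityI subsetI)
  fix D assume D: "D \<in> stacked_complex n (Suc k)"
  then obtain i where i: "i \<le> Suc k" "D \<subseteq> {i..<i + n}" and card: "card D < n"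
    and int: "\<And>i. i < Suc k \<Longrightarrow> D \<noteq> {i + 1..<i + n}"
    by (auto simp: stacked_complex_def)
  show "D \<in> ?R"
  proof (cases "n + k \<in> D")
    case True
    then have "i = Suc k" using i by fastforce
    then have sub: "D - {n + k} \<subseteq> {k + 1..<k + n}" using i by fastforce
    have "finite D" using i finite_subset by blast
    then have "card (D - {n + k}) < n - 1" using True card n by (simp add: card_Diff_singleton)
    moreover have "card {k + 1..<k + n} = n - 1" by simp
    ultimately have "D - {n + k} \<noteq> {k + 1..<k + n}" by (metis less_irrefl)
    then have "D - {n + k} \<in> {D. D \<subset> {k + 1..<k + n}}" using sub by blast
    then show ?thesis using True by (intro UnI2 image_eqI[of _ _ "D - {n + k}"]) auto
  next
    case False
    have "D \<subseteq> {min i k..<min i k + n}"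
    proof
      fix x assume "x \<in> D"
      then have "x \<in> {i..<i + n}" "x \<noteq> n + k" using i False by auto
      then show "x \<in> {min i k..<min i k + n}" using i(1) by auto
    qed
    then have "\<exists>i\<le>k. D \<subseteq> {i..<i + n}" by (intro exI[of _ "min i k"]) auto
    then show ?thesis using card int by (auto simp: stacked_complex_def)
  qed
next
  fix D assume "D \<in> ?R"
  then show "D \<in> stacked_complex n (Suc k)"
  proof
    assume "D \<in> stacked_complex n k - {{k + 1..<k + n}}"
    then show ?thesis unfolding stacked_complex_def
      by (auto simp: less_Suc_eq intro: le_SucI)
  next
    assume "D \<in> insert (n + k) ` {D. D \<subset> {k + 1..<k + n}}"
    then obtain D' where D': "D = insert (n + k) D'" "D' \<subset> {k + 1..<k + n}" by blast
    then have "card D' < card {k + 1..<k + n}" by (intro psubset_card_mono) auto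
    moreover have "finite D'" using D'(2) finite_subset[of D' "{k + 1..<k + n}"] by auto
    moreover have "n + k \<notin> D'" using D'(2) by auto
    ultimately have "card D < n" using D'(1) n by simp
    moreover have "D \<subseteq> {Suc k..<Suc k + n}" using D' n by auto
    moreover have "D \<noteq> {i + 1..<i + n}" if "i < Suc k" for i
    proof -
      have "n + k \<in> D" "n + k \<notin> {i + 1..<i + n}" using D'(1) that by auto
      then show ?thesis by blast
    qed
    ultimately show ?thesis unfolding stacked_complex_def by blast
  qed
qed

lemma Pow_last_interior_face:
  assumes n: "n \<ge> 2"
  shows "Pow {k + 1..<k + n} \<subseteq> stacked_complex n k"
proof
  fix D assume "D \<in> Pow {k + 1..<k + n}"
  then have D: "D \<subseteq> {k + 1..<k + n}" by simp
  then have "card D \<le> card {k + 1..<k + n}" by (intro card_mono) auto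
  moreover have "D \<subseteq> {k..<k + n}" using D by auto
  moreover have "D \<noteq> {i + 1..<i + n}" if "i < k" for i
  proof -
    have "i + 1 \<in> {i + 1..<i + n}" "i + 1 \<notin> {k + 1..<k + n}" using n that by auto
    then show ?thesis using D by blast
  qed
  ultimately show "D \<in> stacked_complex n k" using n by (auto simp: stacked_complex_def)
qed

lemma singleton_in_stacked_complex:
  assumes "n \<ge> 3 \<or> n = 2 \<and> k = 0"
  shows "{z} \<in> stacked_complex n k \<longleftrightarrow> z < n + k"
proof
  assume "{z} \<in> stacked_complex n k"
  then show "z < n + k" using stacked_complex_bounded by blast
next
  assume "z < n + k"
  then have "{z} \<subseteq> {min z k..<min z k + n}" using assms by auto
  moreover have "{z} \<noteq> {i + 1..<i + n}" if "i < k" for i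
  proof
    assume "{z} = {i + 1..<i + n}"
    then have "card {z} = card {i + 1..<i + n}" by simp
    then show False using assms that by simp
  qed
  ultimately show "{z} \<in> stacked_complex n k"
    unfolding stacked_complex_def using assms by (auto intro!: exI[of _ "min z k"])
qed

section \<open>The words between two cyclic words\<close>

lemma distinct_adj_cyclic_word:
  assumes "inj_on s {1..n}" "n \<ge> 2 \<or> k \<le> 1"
  shows "distinct_adj (cyclic_word n s k)"
proof (cases "k \<le> 1")
  case True
  then have "k = 0 \<or> k = 1" by auto
  then show ?thesis by (auto simp: cyclic_word_def)
next
  case False
  then have n: "n \<ge> 2" using assms by simp
  have "i mod n \<noteq> Suc i mod n" for i
    using n by (simp add: mod_Suc)
  then show ?thesis
    using n assms(1)
    by (simp add: distinct_adj_conv_nth cyclic_word_conv_map cyclic_letter_eq_iff)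
qed

text \<open>Containing \<open>C\<^sub>k\<close> forces the deleted set into a window of \<open>n\<close> consecutive positions. If it
  fills the window the word is \<open>C\<^sub>k\<close> itself; otherwise it has fewer than \<open>n\<close> elements, and having
  no equal neighbours excludes exactly the interior ridges.\<close>

lemma word_interval_eq:
  assumes n: "n \<ge> 2 \<or> n = 1 \<and> k = 0" and inj: "inj_on s {1..n}"
  shows "{xs. distinct_adj xs \<and> subseq (cyclic_word n s k) xs \<and> subseq xs (cyclic_word n s (n + k))}
    = insert (cyclic_word n s k) (delete_positions n s (n + k) ` stacked_complex n k)"
    (is "?L = ?R")
proof -
  have n1: "n \<ge> 1" using n by auto
  show ?thesis
  proof (intro equalityI subsetI)
    fix xs assume xs: "xs \<in> ?L"
    then obtain D where D: "D \<subseteq> {..<n + k}" "xs = delete_positions n s (n + k) D"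
      using subseq_delete_positionsE[of xs n s "n + k" "{}"] by (auto simp: delete_positions_empty)
    have window: "\<exists>i\<le>k. D \<subseteq> {i..<i + n}"
      using xs D cyclic_word_subseq_iff[OF n1 inj] by blast
    show "xs \<in> ?R"
    proof (cases "card D < n")
      case True
      then have "D \<in> stacked_complex n k"
        using window xs D distinct_adj_delete_positions_iff[OF n1 inj D(1)]
        by (auto simp: stacked_complex_def add.commute)
      then show ?thesis using D by blast
    next
      case False
      then have "D = {i..<i + n}" if "D \<subseteq> {i..<i + n}" for i
        using that by (intro card_seteq) auto
      then show ?thesis using window D delete_window[OF n1 inj] by blast
    qed
  next
    fix xs assume "xs \<in> ?R"
    then consider "xs = cyclic_word n s k"
      | D where "D \<in> stacked_complex n k" "xs = delete_positions n s (n + k) D" by blast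
    then show "xs \<in> ?L"
    proof cases
      case 1
      have "distinct_adj xs" unfolding 1 using n inj by (intro distinct_adj_cyclic_word) auto
      moreover have "subseq xs (delete_positions n s (n + k) {})"
        unfolding 1 using cyclic_word_subseq_iff[OF n1 inj, of "{}" k] by blast
      ultimately show ?thesis using 1 by (simp add: delete_positions_empty)
    next
      case 2
      note D = stacked_complex_bounded[OF 2(1)]
      have "distinct_adj xs"
        using 2 D distinct_adj_delete_positions_iff[OF n1 inj D]
        by (auto simp: stacked_complex_def)
      moreover have "subseq (cyclic_word n s k) xs"
        using 2 cyclic_word_subseq_iff[OF n1 inj D] by (auto simp: stacked_complex_def)
      moreover have "subseq xs (delete_positions n s (n + k) {})"
        unfolding 2 by (rule subseq_delete_positions_mono) simp
      ultimately show ?thesis by (simp add: delete_positions_empty)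
    qed
  qed
qed

text \<open>The bottom element \<open>C\<^sub>k\<close> can arise from several deleted sets, namely all windows of length
  \<open>n\<close>. It is labelled by the set of all positions instead, which contains every other label.\<close>

lemma word_order:
  fixes s :: "nat \<Rightarrow> 'a"
  assumes n: "n \<ge> 1" and inj: "inj_on s {1..n}"
    and D: "D \<in> insert {..<n + k} (stacked_complex n k)"
    and E: "E \<in> insert {..<n + k} (stacked_complex n k)"
  defines "w \<equiv> (delete_positions n s (n + k))({..<n + k} := cyclic_word n s k)"
  shows "subseq (w E) (w D) \<longleftrightarrow> D \<subseteq> E"
proof (cases "E = {..<n + k}")
  case True
  have "subseq (cyclic_word n s k) (w D)"
  proof (cases "D = {..<n + k}")
    case False
    then have D': "D \<in> stacked_complex n k" using D by simp
    then have "\<exists>i\<le>k. D \<subseteq> {i..<i + n}" by (simp add: stacked_complex_def)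
    then show ?thesis
      using cyclic_word_subseq_iff[OF n inj stacked_complex_bounded[OF D']] False by (simp add: w_def)
  qed (simp add: w_def)
  moreover have "D \<subseteq> E" using D True stacked_complex_bounded by blast
  ultimately show ?thesis using True by (simp add: w_def)
next
  case False
  then have E': "E \<in> stacked_complex n k" using E by simp
  note Esub = stacked_complex_bounded[OF E']
  have card: "card E < n" using E' by (simp add: stacked_complex_def)
  show ?thesis
  proof (cases "D = {..<n + k}")
    case True
    have "length (w E) = n + k - card E"
      using False length_delete_positions[OF Esub] by (simp add: w_def)
    moreover have "length (w D) = k" using True by (simp add: w_def cyclic_word_conv_map)
    ultimately have "\<not> subseq (w E) (w D)" using card list_emb_length[of "(=)" "w E" "w D"] by auto
    moreover have "\<not> D \<subseteq> E" using True False Esub by blast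
    ultimately show ?thesis by blast
  next
    case D_ne: False
    then have "D \<in> stacked_complex n k" using D by simp
    then show ?thesis
      using subseq_delete_positions_iff[OF n inj stacked_complex_bounded Esub card] False D_ne
      by (simp add: w_def)
  qed
qed

section \<open>Faces of a shaved polytope\<close>

text \<open>For a simple polytope with numbered facets, \<open>\<psi> D\<close> is the intersection of the facets with number
  in \<open>D\<close>, and \<open>\<Delta>\<close> is the boundary complex of the dual polytope. The empty face is left out, since
  its natural label, the set of all facets, changes whenever a new facet appears.\<close>

definition face_labelling :: "'e::euclidean_space set \<Rightarrow> nat set set \<Rightarrow> (nat set \<Rightarrow> 'e set) \<Rightarrow> bool" where
  "face_labelling P \<Delta> \<psi> \<longleftrightarrow>
     \<psi> ` \<Delta> = face_lattice P - {{}} \<and> (\<forall>D\<in>\<Delta>. \<forall>E\<in>\<Delta>. \<psi> E \<subseteq> \<psi> D \<longleftrightarrow> D \<subseteq> E)"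

text \<open>The facets of a simplex are numbered by the opposite vertices.\<close>

lemma face_labelling_simplex:
  assumes indep: "\<not> affine_dependent C" and v: "bij_betw v {..<n} C"
  shows "face_labelling (convex hull C) {D. D \<subset> {..<n}} (\<lambda>D. convex hull (v ` ({..<n} - D)))"
proof -
  have sub: "convex hull A \<subseteq> convex hull B \<longleftrightarrow> A \<subseteq> B" if "A \<subseteq> C" "B \<subseteq> C" for A B
  proof
    assume *: "convex hull A \<subseteq> convex hull B"
    show "A \<subseteq> B"
    proof (rule ccontr)
      assume "\<not> A \<subseteq> B"
      then obtain x where x: "x \<in> A" "x \<notin> B" by blast
      then have "x \<in> convex hull B" using * hull_subset[of A convex] by blast
      then have "x \<in> affine hull B" using convex_hull_subset_affine_hull by blast
      moreover have "affine hull B \<subseteq> affine hull (C - {x})"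
        using that x by (intro hull_mono) auto
      ultimately show False using indep x that unfolding affine_dependent_def by blast
    qed
  qed (rule hull_mono)
  have vC: "v ` {..<n} = C" and inj: "inj_on v {..<n}"
    using v by (auto simp: bij_betw_def)
  have "(\<lambda>D. convex hull (v ` ({..<n} - D))) ` {D. D \<subset> {..<n}}
      = face_lattice (convex hull C) - {{}}"
  proof (intro equalityI subsetI)
    fix F assume "F \<in> face_lattice (convex hull C) - {{}}"
    then have F: "F face_of convex hull C" "F \<noteq> {}" by (auto simp: face_lattice_def)
    then obtain c where c: "c \<subseteq> C" "F = convex hull c"
      using face_of_convex_hull_affine_independent[OF indep] by auto
    then have "c \<noteq> {}" using F by auto
    let ?D = "{i. i < n \<and> v i \<notin> c}"
    have vD: "v ` ({..<n} - ?D) = c" using c vC by auto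
    then have "?D \<subset> {..<n}" using \<open>c \<noteq> {}\<close> by blast
    then show "F \<in> (\<lambda>D. convex hull (v ` ({..<n} - D))) ` {D. D \<subset> {..<n}}"
      using vD c by (intro image_eqI[of _ _ ?D]) auto
  next
    fix F assume "F \<in> (\<lambda>D. convex hull (v ` ({..<n} - D))) ` {D. D \<subset> {..<n}}"
    then obtain D where "D \<subset> {..<n}" "F = convex hull (v ` ({..<n} - D))" by auto
    moreover from this have "v ` ({..<n} - D) \<subseteq> C" "v ` ({..<n} - D) \<noteq> {}" using vC by blast+
    ultimately show "F \<in> face_lattice (convex hull C) - {{}}"
      unfolding face_lattice_def face_of_convex_hull_affine_independent[OF indep] by auto
  qed
  moreover have "convex hull (v ` ({..<n} - E)) \<subseteq> convex hull (v ` ({..<n} - D)) \<longleftrightarrow> D \<subseteq> E"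
    if "D \<subset> {..<n}" "E \<subset> {..<n}" for D E
  proof -
    have "v ` ({..<n} - E) \<subseteq> v ` ({..<n} - D) \<longleftrightarrow> {..<n} - E \<subseteq> {..<n} - D"
      using inj_on_image_mem_iff[OF inj, of _ "{..<n} - D"]
      by (auto simp: image_subset_iff)
    also have "\<dots> \<longleftrightarrow> D \<subseteq> E" using that by blast
    finally show ?thesis
      using sub[of "v ` ({..<n} - E)" "v ` ({..<n} - D)"] vC by blast
  qed
  ultimately show ?thesis by (simp add: face_labelling_def)
qed

lemma ex_simplex:
  assumes "d \<le> DIM('e::euclidean_space)"
  obtains C :: "'e::euclidean_space set" where "\<not> affine_dependent C" "card C = d + 1"
proof -
  obtain T :: "'e set" where T: "affine T" "aff_dim T = int d"
    using choose_affine_subset[of "UNIV :: 'e set" "int d"] assms by auto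
  obtain C :: "'e set" where "\<not> affine_dependent C" "affine hull C = affine hull T"
    using affine_basis_exists by blast
  moreover from this have "card C = d + 1"
    using T aff_dim_affine_hull[of C] aff_dim_affine_hull[of T] by (simp add: affine_independent_iff_card)
  ultimately show thesis using that by blast
qed

lemma ex_vertex_separation:
  fixes P :: "'e::euclidean_space set"
  assumes P: "polytope P" and v: "v extreme_point_of P"
  obtains a b where "a \<bullet> v > b" "\<And>w. w extreme_point_of P \<Longrightarrow> w \<noteq> v \<Longrightarrow> a \<bullet> w < b"
proof -
  let ?V = "{w. w extreme_point_of P \<and> w \<noteq> v}"
  have "finite {w. w extreme_point_of P}"
    using P by (simp add: finite_polyhedron_extreme_points polytope_imp_polyhedron)
  then have fin: "finite ?V" by (rule rev_finite_subset) auto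
  have conv: "convex (P - {v})" and "v \<in> P"
    using P v extreme_point_of_stillconvex polytope_imp_convex by blast+
  have "convex hull ?V \<subseteq> P - {v}"
    using conv by (intro hull_minimal) (auto simp: extreme_point_of_def)
  then have "v \<notin> convex hull ?V" by blast
  moreover have "closed (convex hull ?V)"
    using fin by (simp add: compact_convex_hull compact_imp_closed finite_imp_compact)
  ultimately obtain a b where ab: "a \<bullet> v < b" "\<forall>x \<in> convex hull ?V. a \<bullet> x > b"
    using separating_hyperplane_closed_point[of "convex hull ?V" v] by auto
  show thesis
  proof (rule that[of "-b" "-a"])
    show "- b < - a \<bullet> v" using ab by simp
    fix w assume "w extreme_point_of P" "w \<noteq> v"
    then have "w \<in> convex hull ?V" by (intro hull_inc) auto
    then show "- a \<bullet> w < - b" using ab by simp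
  qed
qed

text \<open>The smallest face containing \<open>x\<close> works: the relative boundary of a face is covered by its
  facets, which are smaller faces.\<close>

lemma ex_face_rel_interior:
  fixes P :: "'e::euclidean_space set"
  assumes P: "polytope P" and x: "x \<in> P"
  shows "\<exists>F. F face_of P \<and> x \<in> rel_interior F"
proof -
  let ?A = "{F. F face_of P \<and> x \<in> F}"
  let ?F = "\<Inter>?A"
  have "P \<in> ?A" using P x by (simp add: face_of_refl polytope_imp_convex)
  then have face: "?F face_of P" by (intro face_of_Inter) auto
  have "polyhedron ?F"
    using face P face_of_polytope_polytope polytope_imp_polyhedron by blast
  have "x \<in> rel_interior ?F"
  proof (rule ccontr)
    assume "x \<notin> rel_interior ?F"
    then have "x \<in> rel_frontier ?F"
      using closure_subset[of ?F] by (auto simp: rel_frontier_def)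
    then obtain G where G: "G facet_of ?F" "x \<in> G"
      using rel_frontier_of_polyhedron[OF \<open>polyhedron ?F\<close>] by auto
    then have "G face_of P" using face face_of_trans facet_of_imp_face_of by blast
    then have "?F \<subseteq> G" using G by blast
    moreover have "G \<subseteq> ?F" using G facet_of_imp_subset by blast
    ultimately have "G = ?F" by blast
    then show False using G(1) facet_of_irrefl by metis
  qed
  then show ?thesis using face by blast
qed

text \<open>A vertex together with a hyperplane that separates it from all other vertices, as in the
  definition of shaving.\<close>

locale vertex_cut =
  fixes P :: "'e::euclidean_space set" and v a :: 'e and b :: real
  assumes polytope: "polytope P"
    and vertex: "v extreme_point_of P"
    and above: "a \<bullet> v > b"
    and below: "\<And>w. w extreme_point_of P \<Longrightarrow> w \<noteq> v \<Longrightarrow> a \<bullet> w < b"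
begin

abbreviation "halfspace \<equiv> {x. a \<bullet> x \<le> b}"
abbreviation "hyperplane \<equiv> {x. a \<bullet> x = b}"

lemma face_hull: "F face_of P \<Longrightarrow> F = convex hull {x. x extreme_point_of F}"
  by (intro Krein_Milman_Minkowski polytope_imp_compact polytope_imp_convex
      face_of_polytope_polytope[OF polytope])

lemma face_below:
  assumes F: "F face_of P" and "v \<notin> F" and "x \<in> F"
  shows "a \<bullet> x < b"
proof -
  have "{x. x extreme_point_of F} \<subseteq> {x. a \<bullet> x < b}"
    using below assms by (auto simp: extreme_point_of_face[OF F])
  then have "convex hull {x. x extreme_point_of F} \<subseteq> {x. a \<bullet> x < b}"
    by (intro hull_minimal convex_halfspace_lt)
  then show ?thesis using face_hull[OF F] assms(3) by auto
qed

lemma face_rel_interior_below: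
  assumes F: "F face_of P" "F \<noteq> {}" "F \<noteq> {v}"
  shows "\<exists>x \<in> rel_interior F. a \<bullet> x < b"
proof -
  have "\<exists>w. w extreme_point_of F \<and> w \<noteq> v"
  proof (rule ccontr)
    assume "\<not> ?thesis"
    then have "{x. x extreme_point_of F} \<subseteq> {v}" by auto
    then have "{x. x extreme_point_of F} = {} \<or> {x. x extreme_point_of F} = {v}" by auto
    then show False using face_hull[OF F(1)] F by auto
  qed
  then obtain w where w: "w extreme_point_of F" "w \<noteq> v" by blast
  then have "w \<in> F" "a \<bullet> w < b" using below extreme_point_of_face[OF F(1)] by auto
  moreover have "closure (rel_interior F) = closure F"
    using F face_of_imp_convex convex_closure_rel_interior by blast
  ultimately have "w \<in> closure (rel_interior F)" using closure_subset by auto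
  moreover have "open {x. a \<bullet> x < b}" by (rule open_halfspace_lt)
  ultimately have "rel_interior F \<inter> {x. a \<bullet> x < b} \<noteq> {}"
    using \<open>a \<bullet> w < b\<close> by (metis IntI closure_approachable empty_iff mem_Collect_eq open_dist)
  then show ?thesis by auto
qed

lemma face_rel_interior_on:
  assumes F: "F face_of P" "v \<in> F" "F \<noteq> {v}"
  shows "\<exists>x \<in> rel_interior F. a \<bullet> x = b"
proof -
  obtain y where y: "y \<in> rel_interior F" "a \<bullet> y < b"
    using face_rel_interior_below[of F] F by blast
  have "v \<in> closure (rel_interior F)"
    using F face_of_imp_convex convex_closure_rel_interior closure_subset by blast
  moreover have "open {x. a \<bullet> x > b}" by (rule open_halfspace_gt)
  ultimately obtain z where z: "z \<in> rel_interior F" "a \<bullet> z > b"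
    using above by (metis closure_approachable mem_Collect_eq open_dist)
  have "connected (rel_interior F)"
    using F face_of_imp_convex convex_rel_interior convex_connected by blast
  then show ?thesis
    using connected_ivt_hyperplane[of "rel_interior F" y z a b] y z by auto
qed

lemma shaved_face_below: "F face_of P \<Longrightarrow> F \<inter> halfspace face_of P \<inter> halfspace"
  by (intro face_of_slice convex_halfspace_le)

lemma shaved_face_on: "F face_of P \<Longrightarrow> F \<inter> hyperplane face_of P \<inter> halfspace"
proof -
  assume F: "F face_of P"
  have "F \<inter> halfspace \<inter> hyperplane face_of F \<inter> halfspace"
    using F face_of_imp_convex convex_halfspace_le
    by (intro face_of_Int_supporting_hyperplane_le convex_Int) auto
  moreover have "F \<inter> halfspace \<inter> hyperplane = F \<inter> hyperplane" by auto
  ultimately have "F \<inter> hyperplane face_of F \<inter> halfspace" by (simp only:)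
  then show ?thesis using shaved_face_below[OF F] by (rule face_of_trans)
qed

text \<open>A relative interior point \<open>x\<close> of the face \<open>E\<close> is a relative interior point of some face \<open>F\<close> of
  \<open>P\<close>. Depending on whether \<open>x\<close> lies below or on the hyperplane, it is also a relative interior
  point of \<open>F \<inter> halfspace\<close> or of \<open>F \<inter> hyperplane\<close>; two faces that share a relative interior
  point are equal.\<close>

lemma shaved_face_cases:
  assumes E: "E face_of P \<inter> halfspace" "E \<noteq> {}"
  obtains F where "F face_of P" "F \<noteq> {}" "F \<noteq> {v}" "E = F \<inter> halfspace"
  | F where "F face_of P" "v \<in> F" "F \<noteq> {v}" "E = F \<inter> hyperplane"
proof -
  have "convex E" using face_of_imp_convex[OF E(1)] .
  then obtain x where x: "x \<in> rel_interior E" using E(2) rel_interior_eq_empty[of E] by auto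
  then have xQ: "x \<in> P" "a \<bullet> x \<le> b" 
    using rel_interior_subset face_of_imp_subset[OF E(1)] by auto
  obtain F where F: "F face_of P" "x \<in> rel_interior F"
    using ex_face_rel_interior[OF polytope xQ(1)] by blast
  have convF: "convex F" using face_of_imp_convex[OF F(1)] .
  have "F \<noteq> {v}"
    using F(2) above xQ by auto
  have "x \<in> F" using F rel_interior_subset by blast
  show thesis
  proof (cases "a \<bullet> x < b")
    case True
    have "x \<in> interior halfspace"
      using True by (intro interiorI[OF open_halfspace_lt[of a b]]) auto
    then have "x \<in> rel_interior halfspace"
      using interior_subset_rel_interior by blast
    then have "x \<in> rel_interior (F \<inter> halfspace)"
      using F convF convex_rel_interior_inter_two[of F halfspace] by (auto simp: convex_halfspace_le)
    then have "E = F \<inter> halfspace"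
      using x by (intro face_of_eq[OF E(1) shaved_face_below[OF F(1)]]) auto
    then show ?thesis using that(1) F \<open>F \<noteq> {v}\<close> \<open>x \<in> F\<close> by blast
  next
    case False
    then have eq: "a \<bullet> x = b" using xQ by simp
    then have "v \<in> F" using face_below F \<open>x \<in> F\<close> by fastforce
    have "x \<in> rel_interior hyperplane"
      using eq by (simp add: rel_interior_affine affine_hyperplane)
    then have "x \<in> rel_interior (F \<inter> hyperplane)"
      using F convF convex_rel_interior_inter_two[of F hyperplane] by (auto simp: convex_hyperplane)
    then have "E = F \<inter> hyperplane"
      using x by (intro face_of_eq[OF E(1) shaved_face_on[OF F(1)]]) auto
    then show ?thesis using that(2) F \<open>F \<noteq> {v}\<close> \<open>v \<in> F\<close> by blast
  qed
qed

lemma aff_dim_shaved: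
  assumes "P \<noteq> {v}"
  shows "aff_dim (P \<inter> halfspace) = aff_dim P"
proof -
  have conv: "convex P" using polytope polytope_imp_convex by blast
  have "P face_of P" "P \<noteq> {}" using conv vertex by (auto simp: face_of_refl extreme_point_of_def)
  then obtain x where "x \<in> rel_interior P" "a \<bullet> x < b"
    using face_rel_interior_below[of P] assms by blast
  then have "P \<inter> {x. a \<bullet> x < b} \<noteq> {}" using rel_interior_subset by blast
  then have "affine hull (P \<inter> {x. a \<bullet> x < b}) = affine hull P"
    using conv open_halfspace_lt affine_hull_convex_Int_open by blast
  moreover have "affine hull (P \<inter> {x. a \<bullet> x < b}) \<subseteq> affine hull (P \<inter> halfspace)"
    by (intro hull_mono) auto
  moreover have "affine hull (P \<inter> halfspace) \<subseteq> affine hull P"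
    by (intro hull_mono) auto
  ultimately have "affine hull (P \<inter> halfspace) = affine hull P" by blast
  then show ?thesis by (metis aff_dim_affine_hull)
qed

text \<open>The dual picture of shaving is stacking. The vertex \<open>v\<close> disappears, so its label \<open>D0\<close> is
  removed; the new facet \<open>z\<close> has one face for every face of \<open>P\<close> strictly above \<open>v\<close>, that is, for
  every proper subset of \<open>D0\<close>.\<close>

lemma face_labelling_shaved:
  assumes lab: "face_labelling P \<Delta> \<psi>"
    and D0: "Pow D0 \<subseteq> \<Delta>" "\<psi> D0 = {v}" and z: "z \<notin> \<Union>\<Delta>"
  shows "face_labelling (P \<inter> halfspace) (\<Delta> - {D0} \<union> insert z ` {D. D \<subset> D0})
    (\<lambda>D. if z \<in> D then \<psi> (D - {z}) \<inter> hyperplane else \<psi> D \<inter> halfspace)"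
    (is "face_labelling ?Q ?\<Delta>' ?\<psi>'")
proof -
  have img: "\<psi> ` \<Delta> = face_lattice P - {{}}"
    and ord: "\<And>D E. D \<in> \<Delta> \<Longrightarrow> E \<in> \<Delta> \<Longrightarrow> \<psi> E \<subseteq> \<psi> D \<longleftrightarrow> D \<subseteq> E"
    using lab by (auto simp: face_labelling_def)
  have D0\<Delta>: "D0 \<in> \<Delta>" and sub\<Delta>: "\<And>D. D \<subset> D0 \<Longrightarrow> D \<in> \<Delta>" using D0 by auto
  have face: "\<psi> D face_of P" "\<psi> D \<noteq> {}" if "D \<in> \<Delta>" for D
    using that img by (auto simp: face_lattice_def)
  have single: "\<psi> D = {v} \<longleftrightarrow> D = D0" if "D \<in> \<Delta>" for D
    using ord[OF that D0\<Delta>] ord[OF D0\<Delta> that] D0(2) by auto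
  have contains: "v \<in> \<psi> D \<longleftrightarrow> D \<subseteq> D0" if "D \<in> \<Delta>" for D
    using ord[OF that D0\<Delta>] D0(2) by auto
  have fresh: "z \<notin> D" if "D \<in> \<Delta>" for D using that z by blast
  have point_below: "\<exists>x \<in> rel_interior (\<psi> E). a \<bullet> x < b" if "E \<in> \<Delta> - {D0}" for E
    using that face single by (intro face_rel_interior_below) auto
  have point_on: "\<exists>x \<in> rel_interior (\<psi> E). a \<bullet> x = b" if "E \<subset> D0" for E
    using that face single contains sub\<Delta>[OF that] by (intro face_rel_interior_on) auto
  \<comment> \<open>Both kinds of faces of the shaved polytope contain a relative interior point of the
    face that they are cut from, so inclusions between them come from inclusions before the cut.\<close>
  have le_below: "\<psi> E \<inter> halfspace \<subseteq> \<psi> D \<longleftrightarrow> D \<subseteq> E"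
    if D: "D \<in> \<Delta>" and E: "E \<in> \<Delta> - {D0}" for D E
  proof
    assume *: "\<psi> E \<inter> halfspace \<subseteq> \<psi> D"
    obtain x where "x \<in> rel_interior (\<psi> E)" "a \<bullet> x < b"
      using point_below[OF E] by blast
    then have "\<psi> D \<inter> rel_interior (\<psi> E) \<noteq> {}" using * rel_interior_subset by fastforce
    then have "\<psi> E \<subseteq> \<psi> D"
      using subset_of_face_of[of "\<psi> D" P "\<psi> E"] face D E face_of_imp_subset by blast
    then show "D \<subseteq> E" using ord D E by blast
  next
    assume "D \<subseteq> E"
    then show "\<psi> E \<inter> halfspace \<subseteq> \<psi> D" using ord[of D E] D E by blast
  qed
  have le_on: "\<psi> E \<inter> hyperplane \<subseteq> \<psi> D \<longleftrightarrow> D \<subseteq> E" if D: "D \<in> \<Delta>" and E: "E \<subset> D0" for D E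
  proof
    assume *: "\<psi> E \<inter> hyperplane \<subseteq> \<psi> D"
    obtain x where "x \<in> rel_interior (\<psi> E)" "a \<bullet> x = b"
      using point_on[OF E] by blast
    then have "\<psi> D \<inter> rel_interior (\<psi> E) \<noteq> {}" using * rel_interior_subset by fastforce
    then have "\<psi> E \<subseteq> \<psi> D"
      using subset_of_face_of[of "\<psi> D" P "\<psi> E"] face D sub\<Delta>[OF E] face_of_imp_subset by blast
    then show "D \<subseteq> E" using ord D sub\<Delta>[OF E] by blast
  next
    assume "D \<subseteq> E"
    then show "\<psi> E \<inter> hyperplane \<subseteq> \<psi> D" using ord[of D E] D sub\<Delta>[OF E] by blast
  qed
  have not_on: "\<not> \<psi> E \<inter> halfspace \<subseteq> hyperplane" if E: "E \<in> \<Delta> - {D0}" for E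
  proof -
    obtain x where "x \<in> rel_interior (\<psi> E)" "a \<bullet> x < b"
      using point_below[OF E] by blast
    then show ?thesis using rel_interior_subset by fastforce
  qed
  have "?\<psi>' ` ?\<Delta>' = face_lattice ?Q - {{}}"
  proof (intro equalityI subsetI)
    fix F assume "F \<in> ?\<psi>' ` ?\<Delta>'"
    then obtain D where D: "D \<in> ?\<Delta>'" "F = ?\<psi>' D" by blast
    show "F \<in> face_lattice ?Q - {{}}"
    proof (cases "z \<in> D")
      case True
      then obtain D' where D': "D = insert z D'" "D' \<subset> D0" using D fresh by blast
      then have "D - {z} = D'" using fresh sub\<Delta> by blast
      then have F: "F = \<psi> D' \<inter> hyperplane" using D True by simp
      obtain x where "x \<in> rel_interior (\<psi> D')" "a \<bullet> x = b"
        using point_on[OF D'(2)] by blast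
      then have "x \<in> F" using F rel_interior_subset by blast
      moreover have "F face_of ?Q" using F shaved_face_on face sub\<Delta> D' by blast
      ultimately show ?thesis by (auto simp: face_lattice_def)
    next
      case False
      then have D': "D \<in> \<Delta> - {D0}" using D by blast
      have F: "F = \<psi> D \<inter> halfspace" using D False by simp
      obtain x where "x \<in> rel_interior (\<psi> D)" "a \<bullet> x < b"
        using point_below[OF D'] by blast
      then have "x \<in> F" using F rel_interior_subset by fastforce
      moreover have "F face_of ?Q" using F shaved_face_below face D' by blast
      ultimately show ?thesis by (auto simp: face_lattice_def)
    qed
  next
    fix F assume "F \<in> face_lattice ?Q - {{}}"
    then have "F face_of ?Q" "F \<noteq> {}" by (auto simp: face_lattice_def)
    then show "F \<in> ?\<psi>' ` ?\<Delta>'"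
    proof (cases rule: shaved_face_cases)
      case (1 G)
      then obtain D where D: "D \<in> \<Delta>" "G = \<psi> D" using img by (auto simp: face_lattice_def)
      then have "D \<noteq> D0" using 1 D0(2) by blast
      then show ?thesis using D 1 fresh by (intro image_eqI[of _ _ D]) auto
    next
      case (2 G)
      then obtain D where D: "D \<in> \<Delta>" "G = \<psi> D" using img by (auto simp: face_lattice_def)
      then have "D \<subset> D0" using 2 contains D0(2) by blast
      moreover have "insert z D - {z} = D" using fresh D by blast
      ultimately show ?thesis using D 2 by (intro image_eqI[of _ _ "insert z D"]) auto
    qed
  qed
  moreover have "?\<psi>' E \<subseteq> ?\<psi>' D \<longleftrightarrow> D \<subseteq> E" if DE: "D \<in> ?\<Delta>'" "E \<in> ?\<Delta>'" for D E
  proof -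
    have cases: "(z \<notin> D \<and> D \<in> \<Delta> - {D0}) \<or> (z \<in> D \<and> D - {z} \<subset> D0)" if "D \<in> ?\<Delta>'" for D
      using that fresh sub\<Delta> by blast
    have hyp: "hyperplane \<subseteq> halfspace" by auto
    show ?thesis
      using cases[OF DE(1)] cases[OF DE(2)]
    proof (elim disjE conjE)
      assume "z \<notin> D" "D \<in> \<Delta> - {D0}" "z \<notin> E" "E \<in> \<Delta> - {D0}"
      then show ?thesis using le_below[of D E] by auto
    next
      assume *: "z \<notin> D" "D \<in> \<Delta> - {D0}" "z \<in> E" "E - {z} \<subset> D0"
      then have "?\<psi>' E \<subseteq> ?\<psi>' D \<longleftrightarrow> D \<subseteq> E - {z}" using le_on[of D "E - {z}"] hyp by auto
      then show ?thesis using * by blast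
    next
      assume "z \<in> D" "D - {z} \<subset> D0" "z \<notin> E" "E \<in> \<Delta> - {D0}"
      then show ?thesis using not_on[of E] by auto
    next
      assume *: "z \<in> D" "D - {z} \<subset> D0" "z \<in> E" "E - {z} \<subset> D0"
      then have "?\<psi>' E \<subseteq> ?\<psi>' D \<longleftrightarrow> D - {z} \<subseteq> E - {z}"
        using le_on[of "D - {z}" "E - {z}"] sub\<Delta>[of "D - {z}"] by auto
      then show ?thesis using * by blast
    qed
  qed
  ultimately show ?thesis by (simp add: face_labelling_def)
qed

end

text \<open>A maximal label belongs to a minimal nonempty face, which is a vertex.\<close>

lemma ex_vertex_of_maximal_label:
  fixes P :: "'e::euclidean_space set"
  assumes P: "polytope P" and lab: "face_labelling P \<Delta> \<psi>" and D0: "D0 \<in> \<Delta>"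
    and max: "\<And>D. D \<in> \<Delta> \<Longrightarrow> D0 \<subseteq> D \<Longrightarrow> D = D0"
  obtains v where "v extreme_point_of P" "\<psi> D0 = {v}"
proof -
  have img: "\<psi> ` \<Delta> = face_lattice P - {{}}"
    and ord: "\<And>D E. D \<in> \<Delta> \<Longrightarrow> E \<in> \<Delta> \<Longrightarrow> \<psi> E \<subseteq> \<psi> D \<longleftrightarrow> D \<subseteq> E"
    using lab by (auto simp: face_labelling_def)
  have face: "\<psi> D0 face_of P" "\<psi> D0 \<noteq> {}"
    using img D0 by (auto simp: face_lattice_def)
  then have "compact (\<psi> D0)" "convex (\<psi> D0)"
    using P face_of_polytope_polytope polytope_imp_compact polytope_imp_convex by blast+
  then obtain v where "v extreme_point_of \<psi> D0"
    using Krein_Milman_Minkowski face(2) by fastforce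
  then have v: "v extreme_point_of P" "{v} \<subseteq> \<psi> D0" using extreme_point_of_face face by auto
  then have "{v} \<in> \<psi> ` \<Delta>" using img by (simp add: face_lattice_def face_of_singleton)
  then obtain D where "D \<in> \<Delta>" "\<psi> D = {v}" by auto
  then show thesis using v that ord[OF D0] max by metis
qed

text \<open>Facets are the maximal proper faces, which the order-reversing labelling matches with the
  minimal nonempty labels.\<close>

lemma card_facets_of_labelling:
  fixes P :: "'e::euclidean_space set"
  assumes P: "polytope P" and dim: "aff_dim P \<ge> 1" and lab: "face_labelling P \<Delta> \<psi>"
    and empty: "{} \<in> \<Delta>" and singletons: "\<And>z. {z} \<in> \<Delta> \<longleftrightarrow> z \<in> V" and union: "\<Union>\<Delta> \<subseteq> V"
  shows "card (facets P) = card V"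
proof -
  have img: "\<psi> ` \<Delta> = face_lattice P - {{}}"
    and ord: "\<And>D E. D \<in> \<Delta> \<Longrightarrow> E \<in> \<Delta> \<Longrightarrow> \<psi> E \<subseteq> \<psi> D \<longleftrightarrow> D \<subseteq> E"
    using lab by (auto simp: face_labelling_def)
  have conv: "convex P" and "P \<noteq> {}" using P dim polytope_imp_convex by auto
  then have "P \<in> \<psi> ` \<Delta>" using img by (simp add: face_lattice_def face_of_refl)
  then obtain E where E: "E \<in> \<Delta>" "\<psi> E = P" by auto
  have face: "\<psi> D face_of P" "\<psi> D \<noteq> {}" if "D \<in> \<Delta>" for D
    using that img by (auto simp: face_lattice_def)
  have top: "\<psi> D = P \<longleftrightarrow> D = {}" if "D \<in> \<Delta>" for D
  proof -
    have "E = {}" using ord[OF E(1) empty] E(2) face[OF empty] face_of_imp_subset by blast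
    then show ?thesis using E ord[OF that E(1)] by auto
  qed
  have "bij_betw (\<lambda>z. \<psi> {z}) V (facets P)"
    unfolding bij_betw_def
  proof
    show "inj_on (\<lambda>z. \<psi> {z}) V"
    proof (rule inj_onI)
      fix x y assume "x \<in> V" "y \<in> V" "\<psi> {x} = \<psi> {y}"
      then show "x = y" using ord[of "{x}" "{y}"] singletons[of x] singletons[of y] by simp
    qed
    show "(\<lambda>z. \<psi> {z}) ` V = facets P"
      unfolding facets_eq_facet_of[OF dim]
    proof (intro equalityI subsetI)
      fix F assume "F \<in> (\<lambda>z. \<psi> {z}) ` V"
      then obtain z where z: "z \<in> V" "F = \<psi> {z}" by blast
      then have "F face_of P" "F \<noteq> {}" "F \<noteq> P"
        using face[of "{z}"] top[of "{z}"] singletons by auto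
      then obtain G where G: "G facet_of P" "F \<subseteq> G"
        using face_of_polyhedron_subset_facet P polytope_imp_polyhedron by metis
      then have "G \<in> \<psi> ` \<Delta>" using img by (simp add: face_lattice_def facet_of_def)
      then obtain D where D: "D \<in> \<Delta>" "G = \<psi> D" by blast
      then have "D \<subseteq> {z}" using ord[of D "{z}"] G z singletons by auto
      moreover have "D \<noteq> {}" using G D top facet_of_irrefl by metis
      ultimately have "D = {z}" by blast
      then show "F \<in> {F. F facet_of P}" using G D z by simp
    next
      fix F assume "F \<in> {F. F facet_of P}"
      then have F: "F face_of P" "F \<noteq> {}" "aff_dim F = aff_dim P - 1" by (auto simp: facet_of_def)
      then have "F \<in> \<psi> ` \<Delta>" using img by (simp add: face_lattice_def)
      then obtain D where D: "D \<in> \<Delta>" "F = \<psi> D" by blast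
      have "F \<noteq> P" using F(3) by auto
      then have "D \<noteq> {}" using top[OF empty] D by auto
      then obtain z where z: "z \<in> D" by blast
      then have zV: "z \<in> V" "{z} \<in> \<Delta>" using D union singletons by auto
      have "F \<subseteq> \<psi> {z}" using ord[OF zV(2) D(1)] D z by simp
      moreover have "aff_dim (\<psi> {z}) < aff_dim P"
        using face_of_aff_dim_lt[OF conv] face[OF zV(2)] top[OF zV(2)] by blast
      moreover have "aff_dim F < aff_dim (\<psi> {z})" if "F \<noteq> \<psi> {z}"
      proof (rule face_of_aff_dim_lt[OF _ _ that])
        show "convex (\<psi> {z})" using face(1)[OF zV(2)] by (rule face_of_imp_convex)
        show "F face_of \<psi> {z}" using face_of_face[OF face(1)[OF zV(2)]] F(1) \<open>F \<subseteq> \<psi> {z}\<close> by blast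
      qed
      ultimately have "F = \<psi> {z}" using F(3) by force
      then show "F \<in> (\<lambda>z. \<psi> {z}) ` V" using zV by blast
    qed
  qed
  then show ?thesis by (metis bij_betw_same_card)
qed

section \<open>Dual stacked polytopes with prescribed labels\<close>

text \<open>The simplex has the proper subsets of \<open>{..<d + 1}\<close> as labels. Passing from \<open>k\<close> to \<open>k + 1\<close>
  shaves off the vertex whose label is the ridge \<open>{k + 1..<k + d + 1}\<close>; it is a vertex because a
  label with \<open>d\<close> elements is maximal.\<close>

lemma ex_dual_stacked_polytope:
  assumes "d \<ge> 1 \<or> k = 0" and "d \<le> DIM('e::euclidean_space)"
  shows "\<exists>(P :: 'e::euclidean_space set) \<psi>. dual_stacked P \<and> polytope P \<and> aff_dim P = int d \<and>
    face_labelling P (stacked_complex (d + 1) k) \<psi>"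
  using assms(1)
proof (induction k)
  case 0
  obtain C :: "'e set" where C: "\<not> affine_dependent C" "card C = d + 1"
    using ex_simplex[OF assms(2)] .
  then have "finite C" by (simp add: aff_independent_finite)
  then obtain v where "bij_betw v {..<d + 1} C"
    using ex_bij_betw_nat_finite[of C] C by (auto simp: lessThan_atLeast0)
  then have "face_labelling (convex hull C) (stacked_complex (d + 1) 0)
      (\<lambda>D. convex hull (v ` ({..<d + 1} - D)))"
    unfolding stacked_complex_0 by (rule face_labelling_simplex[OF C(1)])
  moreover have simplex: "int d simplex (convex hull C)"
    using C by (simp add: simplex_convex_hull)
  ultimately show ?case
    using dual_stacked.simplex[OF simplex] simplex_imp_polytope[OF simplex] aff_dim_simplex[OF simplex]
    by blast
next
  case (Suc k)
  then have d: "d + 1 \<ge> 2" by simp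
  then obtain P :: "'e set" and \<psi> where stacked: "dual_stacked P" and P: "polytope P"
    and dim: "aff_dim P = int d" and lab: "face_labelling P (stacked_complex (d + 1) k) \<psi>"
    using Suc.IH by auto
  define D0 where "D0 = {k + 1..<k + (d + 1)}"
  have Pow: "Pow D0 \<subseteq> stacked_complex (d + 1) k"
    unfolding D0_def by (rule Pow_last_interior_face[OF d])
  obtain v where v: "v extreme_point_of P" "\<psi> D0 = {v}"
  proof (rule ex_vertex_of_maximal_label[OF P lab])
    show "D0 \<in> stacked_complex (d + 1) k" using Pow by blast
    fix D assume D: "D \<in> stacked_complex (d + 1) k" "D0 \<subseteq> D"
    have "finite D" using stacked_complex_bounded[OF D(1)] finite_subset by blast
    moreover have "card D \<le> card D0" using D(1) by (simp add: stacked_complex_def D0_def)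
    ultimately show "D = D0" using D(2) by (intro card_seteq[symmetric])
  qed
  obtain a b where ab: "a \<bullet> v > b" "\<And>w. w extreme_point_of P \<Longrightarrow> w \<noteq> v \<Longrightarrow> a \<bullet> w < b"
    by (rule ex_vertex_separation[OF P v(1)]) blast
  interpret vertex_cut P v a b
    by unfold_locales (fact P v ab)+
  \<comment> \<open>so \<open>n + k\<close> can serve as the number of the new facet\<close>
  have "n + k \<notin> \<Union>(stacked_complex n k)" for n
    using stacked_complex_bounded by blast
  then have "face_labelling (P \<inter> halfspace) (stacked_complex (d + 1) (Suc k))
    (\<lambda>D. if d + 1 + k \<in> D then \<psi> (D - {d + 1 + k}) \<inter> hyperplane else \<psi> D \<inter> halfspace)"
    unfolding stacked_complex_Suc[OF d] D0_def[symmetric]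
    by (intro face_labelling_shaved[OF lab Pow v(2)])
  moreover have "is_shaving P v (P \<inter> halfspace)"
    using v(1) ab by (auto simp: is_shaving_def)
  then have "dual_stacked (P \<inter> halfspace)" using stacked dual_stacked.shaving by blast
  moreover have "polytope (P \<inter> halfspace)"
    using P by (simp add: polytope_Int_polyhedron polyhedron_halfspace_le)
  moreover have "P \<noteq> {v}" using dim d by auto
  then have "aff_dim (P \<inter> halfspace) = int d" using aff_dim_shaved dim by simp
  ultimately show ?case by blast
qed

lemma card_facets_stacked_complex:
  fixes P :: "'e::euclidean_space set"
  assumes dk: "d \<ge> 2 \<or> k = 0" and P: "polytope P" "aff_dim P = int d"
    and lab: "face_labelling P (stacked_complex (d + 1) k) \<psi>"
  shows "card (facets P) = d + k + 1"
proof (cases "d = 0")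
  case True
  then have "aff_dim F = aff_dim P - 1 \<longleftrightarrow> F = {}" for F :: "'e set"
    using P(2) aff_dim_empty[of F] by simp
  then have "facets P = {{}}" by (auto simp: facets_def)
  then show ?thesis using True dk by simp
next
  case False
  have "card (facets P) = card {..<d + 1 + k}"
  proof (rule card_facets_of_labelling[OF P(1) _ lab])
    show "{} \<in> stacked_complex (d + 1) k"
      using Pow_last_interior_face[of "d + 1" k] False by auto
    show "{z} \<in> stacked_complex (d + 1) k \<longleftrightarrow> z \<in> {..<d + 1 + k}" for z
    proof -
      have "d + 1 \<ge> 3 \<or> d + 1 = 2 \<and> k = 0" using dk False by linarith
      from singleton_in_stacked_complex[OF this] show ?thesis by simp
    qed
    show "\<Union>(stacked_complex (d + 1) k) \<subseteq> {..<d + 1 + k}"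
      using stacked_complex_bounded by blast
  qed (use P False in simp)
  then show ?thesis by simp
qed

text \<open>Any set containing all labels can label the empty face; on the side of words it will label the
  bottom element \<open>C\<^sub>k\<close>.\<close>

lemma face_labelling_insert_empty_face:
  assumes lab: "face_labelling P \<Delta> \<psi>" and T: "T \<notin> \<Delta>" "\<Union>\<Delta> \<subseteq> T"
  shows "(\<psi>(T := {})) ` insert T \<Delta> = face_lattice P"
    and "\<And>D E. D \<in> insert T \<Delta> \<Longrightarrow> E \<in> insert T \<Delta> \<Longrightarrow>
      (\<psi>(T := {})) E \<subseteq> (\<psi>(T := {})) D \<longleftrightarrow> D \<subseteq> E"
proof -
  have img: "\<psi> ` \<Delta> = face_lattice P - {{}}"
    and ord: "\<And>D E. D \<in> \<Delta> \<Longrightarrow> E \<in> \<Delta> \<Longrightarrow> \<psi> E \<subseteq> \<psi> D \<longleftrightarrow> D \<subseteq> E"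
    using lab by (auto simp: face_labelling_def)
  have "(\<psi>(T := {})) ` insert T \<Delta> = insert {} (\<psi> ` \<Delta>)" using T by auto
  moreover have "{} \<in> face_lattice P" by (simp add: face_lattice_def)
  ultimately show "(\<psi>(T := {})) ` insert T \<Delta> = face_lattice P" using img by auto
  fix D E assume DE: "D \<in> insert T \<Delta>" "E \<in> insert T \<Delta>"
  have ne: "\<psi> D \<noteq> {}" if "D \<in> \<Delta>" for D using img that by auto
  have sub: "D \<subseteq> T" "D \<noteq> T" if "D \<in> \<Delta>" for D using T that by auto
  show "(\<psi>(T := {})) E \<subseteq> (\<psi>(T := {})) D \<longleftrightarrow> D \<subseteq> E"
  proof (cases "E = T")
    case True
    then show ?thesis using DE sub by auto
  next
    case False
    then have E: "E \<in> \<Delta>" using DE by simp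
    show ?thesis
    proof (cases "D = T")
      case True
      then show ?thesis using False ne[OF E] sub[OF E] by auto
    next
      case False
      then show ?thesis using \<open>E \<noteq> T\<close> E DE ord by simp
    qed
  qed
qed

section \<open>The Bruhat interval\<close>

lemma inj_on_if_reflects_inclusion:
  assumes "\<And>D E. D \<in> I \<Longrightarrow> E \<in> I \<Longrightarrow> leA (h E) (h D) \<longleftrightarrow> D \<subseteq> E"
  shows "inj_on h I"
proof (rule inj_onI)
  fix D E assume DE: "D \<in> I" "E \<in> I" "h D = h E"
  then have "D \<subseteq> E" "E \<subseteq> D" using assms[of D E] assms[of E D] assms[of D D] by simp_all
  then show "D = E" by blast
qed

text \<open>Two order-reversing parametrisations by the same family of sets compose to an isomorphism, which
  avoids inverting either of them explicitly.\<close>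

lemma poset_isomorphic_common_index:
  fixes I :: "'i set set"
  assumes f: "f ` I = A" "\<And>D E. D \<in> I \<Longrightarrow> E \<in> I \<Longrightarrow> leA (f E) (f D) \<longleftrightarrow> D \<subseteq> E"
    and g: "g ` I = B" "\<And>D E. D \<in> I \<Longrightarrow> E \<in> I \<Longrightarrow> leB (g E) (g D) \<longleftrightarrow> D \<subseteq> E"
  shows "poset_isomorphic A leA B leB"
proof -
  have f_bij: "bij_betw f I A" and g_bij: "bij_betw g I B"
    using inj_on_if_reflects_inclusion[of I leA f, OF f(2)]
      inj_on_if_reflects_inclusion[of I leB g, OF g(2)] f(1) g(1)
    by (simp_all add: bij_betw_def)
  from g_bij have "bij_betw (g \<circ> the_inv_into I f) A B"
    by (rule bij_betw_trans[OF bij_betw_the_inv_into[OF f_bij]])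
  moreover have "leA x y \<longleftrightarrow> leB ((g \<circ> the_inv_into I f) x) ((g \<circ> the_inv_into I f) y)"
    if xy: "x \<in> A" "y \<in> A" for x y
  proof -
    obtain D E where "D \<in> I" "E \<in> I" "x = f D" "y = f E" using xy f(1) by blast
    then show ?thesis
      using f(2) g(2) bij_betw_imp_inj_on[OF f_bij] by (simp add: the_inv_into_f_f)
  qed
  ultimately show ?thesis unfolding poset_isomorphic_def by blast
qed

theorem proposition7p2:
  fixes W :: "('w, 'm) monoid_scheme" and S :: "'w set" and m :: "'w \<Rightarrow> 'w \<Rightarrow> enat"
    and s :: "nat \<Rightarrow> 'w" and d k :: nat
  assumes "universal_coxeter_system W S m"
    and "bij_betw s {1..d + 1} S"
    and "d \<ge> 2 \<or> k = 0"
    and "d \<le> DIM('e::euclidean_space)"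
  shows "\<exists>P :: 'e set.
    dual_stacked P \<and> aff_dim P = int d \<and> card (facets P) = d + k + 1 \<and>
    poset_isomorphic
      (bruhat_interval W S (word_prod W (cyclic_word (d + 1) s k))
                           (word_prod W (cyclic_word (d + 1) s (d + k + 1))))
      (bruhat_le W S)
      (face_lattice P) (\<subseteq>)"
proof -
  let ?n = "d + 1"
  let ?\<Delta> = "stacked_complex ?n k" and ?T = "{..<?n + k}"
  let ?w = "(delete_positions ?n s (?n + k))(?T := cyclic_word ?n s k)"
  have inj: "inj_on s {1..?n}" and S: "s ` {1..?n} = S"
    using assms(2) by (auto simp: bij_betw_def)
  have n: "?n \<ge> 1" and nk: "?n \<ge> 2 \<or> ?n = 1 \<and> k = 0" and dk: "d \<ge> 1 \<or> k = 0"
    using assms(3) by auto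
  obtain P :: "'e set" and \<psi> where P: "dual_stacked P" "polytope P" "aff_dim P = int d"
    and lab: "face_labelling P ?\<Delta> \<psi>"
    using ex_dual_stacked_polytope[OF dk assms(4)] by blast
  have facets: "card (facets P) = d + k + 1"
    using card_facets_stacked_complex[OF assms(3) P(2,3) lab] .
  have T: "?T \<notin> ?\<Delta>" by (simp add: stacked_complex_def)
  have T': "\<Union>?\<Delta> \<subseteq> ?T" using stacked_complex_bounded by blast
  have S_letters: "cyclic_word ?n s j \<in> lists S" for j
    using S by (auto simp: cyclic_word_def)
  have adj: "distinct_adj (cyclic_word ?n s k)" "distinct_adj (cyclic_word ?n s (?n + k))"
    using nk inj by (auto intro!: distinct_adj_cyclic_word)
  have "?w ` insert ?T ?\<Delta> = insert (cyclic_word ?n s k) (delete_positions ?n s (?n + k) ` ?\<Delta>)"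
    using T by auto
  then have words: "?w ` insert ?T ?\<Delta> =
    {xs. distinct_adj xs \<and> subseq (cyclic_word ?n s k) xs \<and> subseq xs (cyclic_word ?n s (?n + k))}"
    unfolding word_interval_eq[OF nk inj] .
  have word: "?w D \<in> lists S" "distinct_adj (?w D)" if "D \<in> insert ?T ?\<Delta>" for D
  proof -
    have *: "distinct_adj (?w D) \<and> subseq (?w D) (cyclic_word ?n s (?n + k))"
      using words that by blast
    then show "distinct_adj (?w D)" by blast
    have "set (?w D) \<subseteq> set (cyclic_word ?n s (?n + k))"
      using * set_nths_subset unfolding subseq_conv_nths by metis
    then show "?w D \<in> lists S" using S_letters[of "?n + k"] by blast
  qed
  have "poset_isomorphic
      (bruhat_interval W S (word_prod W (cyclic_word ?n s k)) (word_prod W (cyclic_word ?n s (?n + k))))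
      (bruhat_le W S) (face_lattice P) (\<subseteq>)"
  proof (rule poset_isomorphic_common_index)
    show "(\<lambda>D. word_prod W (?w D)) ` insert ?T ?\<Delta> = bruhat_interval W S
        (word_prod W (cyclic_word ?n s k)) (word_prod W (cyclic_word ?n s (?n + k)))"
      unfolding bruhat_interval_eq[OF assms(1) S_letters adj(1) S_letters adj(2)] words[symmetric]
      by (simp only: image_image)
    show "bruhat_le W S (word_prod W (?w E)) (word_prod W (?w D)) \<longleftrightarrow> D \<subseteq> E"
      if "D \<in> insert ?T ?\<Delta>" "E \<in> insert ?T ?\<Delta>" for D E
      using bruhat_le_iff_subseq[OF assms(1) word[OF that(2)] word[OF that(1)]]
        word_order[OF n inj that] by (simp only:)
    show "(\<psi>(?T := {})) ` insert ?T ?\<Delta> = face_lattice P"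
      by (rule face_labelling_insert_empty_face(1)[OF lab T T'])
    show "(\<psi>(?T := {})) E \<subseteq> (\<psi>(?T := {})) D \<longleftrightarrow> D \<subseteq> E"
      if "D \<in> insert ?T ?\<Delta>" "E \<in> insert ?T ?\<Delta>" for D E
      by (rule face_labelling_insert_empty_face(2)[OF lab T T' that])
  qed
  then show ?thesis using P facets by (auto simp: add.commute add.left_commute)
qed

end
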